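(* Let $\lambda\in(0,1)$. There exist $C_1,C_2>0$ such that for every $k\in\mathbb N$, $k\ge1$, $$C_1k^2\le\gamma^\lambda(1,k)\le C_2k^2.$$
   Context: Vectors and lattice. Let $\mathrm w_1=(1,0)$, $\mathrm w_2=(\frac12,\frac{\sqrt3}2)$. For $\rho\in(0,1]$ put $\mathcal L_1^-=\{\xi_1\mathrm w_1+\xi_2\mathrm w_2\colon\xi_1,\xi_2\in\mathbb Z,\ \xi_1<0\}$, $\mathcal L_\rho^+=\{\xi_1\mathrm w_1+\xi_2\mathrm w_2\colon\xi_1,\xi_2\in\rho\mathbb Z,\ \xi_1\ge0\}$, $\mathcal L_\rho=\mathcal L_1^-\cup\mathcal L_\rho^+$. Triangulation $\mathcal T_\rho$ and nearest neighbours. A triangulation of $\mathcal L_\rho$ (partition of $\mathbb R^2$, up to boundaries, into open nonempty triangles with vertices in $\mathcal L_\rho$) has the Delaunay property if the circumcircle of each triangle contains no points of $\mathcal L_\rho$ in its interior. Put $P_i=-\mathrm w_1+i\mathrm w_2$, $Q_j=j\rho\mathrm w_2$ ($i,j\in\mathbb Z$). The triangulation with the Delaunay property is unique unless for some $i,j$ the points $P_i,P_{i+1},Q_j,Q_{j+1}$ lie on a common circle. $\mathcal T_\rho$ denotes the triangulation of $\mathcal L_\rho$ with the Delaunay property in which, by convention, every such concyclic 4-tuple is triangulated by $P_iQ_jQ_{j+1}$ and $P_iP_{i+1}Q_{j+1}$. Two distinct points of $\mathcal L_\rho$ are nearest neighbours (NN) if they are vertices of one and the same triangle of $\mathcal T_\rho$.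 (For $\rho=1$, $\mathcal L_1$ is the hexagonal Bravais lattice, $\mathcal T_1$ is its partition into unit equilateral triangles, and NN are the pairs at distance $1$.) Transition cost. Let $\Omega_{k,\infty}=\mathbb R\times(0,\frac{\sqrt3}2k)$, $\mathcal L_{\rho,\infty}(k)=\mathcal L_\rho\cap\overline\Omega_{k,\infty}$, and let $\mathcal L^-_{1,\infty}(k)$, $\mathcal L^+_{\rho,\infty}(k)$ be its subsets of points $\xi_1\mathrm w_1+\xi_2\mathrm w_2$ with $\xi_1<0$, respectively $\xi_1\ge0$. $\mathcal A_{\rho,\infty}(\Omega_{k,\infty})$ is the set of $u\in C^0(\overline\Omega_{k,\infty};\mathbb R^2)$ piecewise affine with $\nabla u$ constant on $\Omega_{k,\infty}\cap T$ for all $T\in\mathcal T_\rho$ and $\det\nabla u>0$ a.e. For such $u$, $$\mathcal E_\infty^\lambda(u,\rho,k)=\tfrac12\sum_{\substack{x,y\ \mathrm{NN}\\ x\in\mathcal L^-_{1,\infty}(k),\,y\in\mathcal L_{\rho,\infty}(k)}}(|u(x)-u(y)|-1)^2+\tfrac12\sum_{\substack{x,y\ \mathrm{NN}\\ x\in\mathcal L^+_{\rho,\infty}(k),\,y\in\mathcal L_{\rho,\infty}(k)}}(|u(x)-u(y)|-\lambda)^2,$$ the sums being over ordered pairs $(x,y)$. Then $\gamma^\lambda(\rho,k)$ is the infimum of $\mathcal E^\lambda_\infty(v,\rho,k)$ over all $M>0$ and $v\in\mathcal A_{\rho,\infty}(\Omega_{k,\infty})$ with $\nabla v=I$ for $x_1\in(-\infty,-M)$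 and $\nabla v=\frac\lambda\rho I$ for $x_1\in(M,+\infty)$. *)

theory Defs
  imports "HOL-Analysis.Analysis"
begin

definition w1 :: "real^2" where
  "w1 = vector [1, 0]"

definition w2 :: "real^2" where
  "w2 = vector [1/2, sqrt 3 / 2]"

definition lattice_minus :: "(real^2) set" where
  "lattice_minus = {of_int a *\<^sub>R w1 + of_int b *\<^sub>R w2 | a b :: int. a < 0}"

definition lattice_plus :: "real \<Rightarrow> (real^2) set" where
  "lattice_plus \<rho> =
     {(\<rho> * of_int a) *\<^sub>R w1 + (\<rho> * of_int b) *\<^sub>R w2 | a b :: int. 0 \<le> \<rho> * of_int a}"

definition lattice :: "real \<Rightarrow> (real^2) set" where
  "lattice \<rho> = lattice_minus \<union> lattice_plus \<rho>"

text \<open>A triangle is encoded by the set of its three vertices; the open triangle itself is the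
  interior of their convex hull, nonempty exactly when the vertices are affinely independent.\<close>

definition open_triangle :: "(real^2) set \<Rightarrow> (real^2) set" where
  "open_triangle V = interior (convex hull V)"

definition triangulation :: "(real^2) set \<Rightarrow> (real^2) set set \<Rightarrow> bool" where
  "triangulation L T \<longleftrightarrow>
     (\<forall>V\<in>T. V \<subseteq> L \<and> card V = 3 \<and> open_triangle V \<noteq> {}) \<and>
     (\<forall>V\<in>T. \<forall>W\<in>T. V \<noteq> W \<longrightarrow> open_triangle V \<inter> open_triangle W = {}) \<and>
     (\<Union>V\<in>T. closure (open_triangle V)) = UNIV"

definition delaunay :: "(real^2) set \<Rightarrow> (real^2) set set \<Rightarrow> bool" where
  "delaunay L T \<longleftrightarrow> (\<forall>V\<in>T. \<forall>c r. V \<subseteq> sphere c r \<longrightarrow> ball c r \<inter> L = {})"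

definition P_pt :: "int \<Rightarrow> real^2" where
  "P_pt i = - w1 + of_int i *\<^sub>R w2"

definition Q_pt :: "real \<Rightarrow> int \<Rightarrow> real^2" where
  "Q_pt \<rho> j = (of_int j * \<rho>) *\<^sub>R w2"

definition tie_convention :: "real \<Rightarrow> (real^2) set set \<Rightarrow> bool" where
  "tie_convention \<rho> T \<longleftrightarrow>
     (\<forall>i j. (\<exists>c r. {P_pt i, P_pt (i + 1), Q_pt \<rho> j, Q_pt \<rho> (j + 1)} \<subseteq> sphere c r) \<longrightarrow>
        {P_pt i, Q_pt \<rho> j, Q_pt \<rho> (j + 1)} \<in> T \<and>
        {P_pt i, P_pt (i + 1), Q_pt \<rho> (j + 1)} \<in> T)"

text \<open>For \<open>0 < \<rho> \<le> 1\<close> there is exactly one such triangulation, so the description is proper.\<close>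

definition lattice_triangulation :: "real \<Rightarrow> (real^2) set set" where
  "lattice_triangulation \<rho> =
     (THE T. triangulation (lattice \<rho>) T \<and> delaunay (lattice \<rho>) T \<and> tie_convention \<rho> T)"

definition nearest_neighbours :: "real \<Rightarrow> real^2 \<Rightarrow> real^2 \<Rightarrow> bool" where
  "nearest_neighbours \<rho> x y \<longleftrightarrow> x \<noteq> y \<and> (\<exists>V\<in>lattice_triangulation \<rho>. x \<in> V \<and> y \<in> V)"

definition strip :: "nat \<Rightarrow> (real^2) set" where
  "strip k = {x. 0 < x $ 2 \<and> x $ 2 < sqrt 3 / 2 * real k}"

definition strip_lattice :: "real \<Rightarrow> nat \<Rightarrow> (real^2) set" where
  "strip_lattice \<rho> k = lattice \<rho> \<inter> closure (strip k)"

definition strip_lattice_minus :: "nat \<Rightarrow> (real^2) set" where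
  "strip_lattice_minus k = lattice_minus \<inter> closure (strip k)"

definition strip_lattice_plus :: "real \<Rightarrow> nat \<Rightarrow> (real^2) set" where
  "strip_lattice_plus \<rho> k = lattice_plus \<rho> \<inter> closure (strip k)"

text \<open>Deformations are total functions; only their values on \<open>closure (strip k)\<close> matter.
  Each \<open>strip k \<inter> open_triangle V\<close> is open and convex, so a constant gradient there
  means that \<open>u\<close> is affine there.\<close>

definition admissible :: "real \<Rightarrow> nat \<Rightarrow> (real^2 \<Rightarrow> real^2) set" where
  "admissible \<rho> k =
     {u. continuous_on (closure (strip k)) u \<and>
         (\<forall>V\<in>lattice_triangulation \<rho>. \<exists>A :: real^2^2.
            \<forall>x\<in>strip k \<inter> open_triangle V. (u has_derivative (\<lambda>h. A *v h)) (at x)) \<and>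
         (AE x in lebesgue. x \<in> strip k \<longrightarrow> det (jacobian u (at x)) > 0)}"

text \<open>The sums are unconditional sums in \<open>[0, \<infinity>]\<close>, hence always meaningful.\<close>

definition energy :: "real \<Rightarrow> (real^2 \<Rightarrow> real^2) \<Rightarrow> real \<Rightarrow> nat \<Rightarrow> ennreal" where
  "energy lam u \<rho> k =
     (1/2) * (\<Sum>\<^sub>\<infinity>(x, y)\<in>{(x, y). nearest_neighbours \<rho> x y \<and>
                  x \<in> strip_lattice_minus k \<and> y \<in> strip_lattice \<rho> k}.
                ennreal ((norm (u x - u y) - 1)\<^sup>2)) +
     (1/2) * (\<Sum>\<^sub>\<infinity>(x, y)\<in>{(x, y). nearest_neighbours \<rho> x y \<and>
                  x \<in> strip_lattice_plus \<rho> k \<and> y \<in> strip_lattice \<rho> k}.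
                ennreal ((norm (u x - u y) - lam)\<^sup>2))"

definition transition_cost :: "real \<Rightarrow> real \<Rightarrow> nat \<Rightarrow> ennreal" where
  "transition_cost lam \<rho> k =
     Inf {energy lam v \<rho> k | v M. M > (0::real) \<and> v \<in> admissible \<rho> k \<and>
        (\<forall>x\<in>strip k. x $ 1 < - M \<longrightarrow>
           (v has_derivative (\<lambda>h. mat 1 *v h)) (at x)) \<and>
        (\<forall>x\<in>strip k. x $ 1 > M \<longrightarrow>
           (v has_derivative (\<lambda>h. ((lam / \<rho>) *\<^sub>R mat 1) *v h)) (at x))}"

end

theory Submission
  imports Defs
begin

text \<open>The lattice points are written as \<open>s w1 + t w2\<close> with integers \<open>s, t\<close>; the interface runs between
the columns \<open>s = -1\<close> and \<open>s = 0\<close>. For \<open>\<rho> = 1\<close> the Delaunay triangulation is the partition into unit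
equilateral triangles, so the energy is a sum over the six bond directions.

\<^bold>\<open>Upper bound.\<close> The deformation \<open>compression\<close> lowers the vertical spacing from \<open>1\<close> to \<open>lam\<close> one row after
the other: row \<open>t\<close> of the strip does so where it crosses the line \<open>s + t = k\<close>, which is a line of the
triangulation. All bonds starting in a column outside \<open>0 \<le> s \<le> k\<close> are relaxed, and
the remaining \<open>O(k\<^sup>2)\<close> bonds have bounded length.

\<^bold>\<open>Lower bound.\<close> If a triangle with vertices \<open>p, q, r\<close> is positively oriented, then the linear quantity
\<open>p + \<omega> q + \<omega>\<^sup>2 r\<close>, where \<open>\<omega>\<close> is a primitive cube root of unity, measures how far it is from being
equilateral, and its square is bounded, up to a constant factor, by the sum of the squared deviations of the three
side lengths from any common value (\<open>equilateral_defect\<close>). This holds on both sides of the interface, whatever the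
rest length, so a deformation \<open>U\<close> of small energy is almost conformal across the interface.
The discrete Laplacian of \<open>U\<close> is a combination of these defects, hence \<open>U\<close> differs from its
harmonic replacement \<open>h\<close> in a box of side \<open>\<sim> k\<close> by a function whose Dirichlet energy is controlled by
the energy of \<open>U\<close> (\<open>replacement_estimate\<close>). Being harmonic, the difference
\<open>d(x) = h(x + w2) - h(x)\<close> has a subharmonic squared norm. But \<open>|d|\<^sup>2\<close> is close to the squared rest length,
which is \<open>1\<close> on the left and \<open>lam\<^sup>2 < 1\<close> on the right, and this step function is far from
subharmonic: tested against a bump whose peak lies to the left of the interface, its Laplacian gives a
quantity of order \<open>-k\<^sup>8\<close> (\<open>step_profile_flux\<close>), while the error is of order \<open>k\<^sup>6\<close>
times the sum over the box of \<open>||d|\<^sup>2 - rest\<^sup>2|\<close>. This forces an energy of order \<open>k\<^sup>2\<close>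
(\<open>discrete_transition_bound\<close>). For small \<open>k\<close> it is enough that the bonds between the columns
\<open>-1\<close> and \<open>0\<close> are counted with both rest lengths (\<open>energy_lower_interface\<close>).\<close>

section \<open>The Laplacian of the triangular lattice\<close>

text \<open>The lattice is indexed by pairs of integers, the coordinates with respect to \<open>w1\<close> and \<open>w2\<close>. The
six neighbours of a point are obtained by adding or subtracting \<open>e1\<close>, \<open>e2\<close>, \<open>e3\<close>.\<close>
abbreviation e1 :: "int \<times> int" where "e1 \<equiv> (1, 0)"
abbreviation e2 :: "int \<times> int" where "e2 \<equiv> (0, 1)"
abbreviation e3 :: "int \<times> int" where "e3 \<equiv> (1, -1)"

text \<open>The six-point Laplacian of the triangular lattice, without normalisation.\<close>
definition laplace :: "(int \<times> int \<Rightarrow> 'a::real_vector) \<Rightarrow> int \<times> int \<Rightarrow> 'a" where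
  "laplace f x = f (x + e1) + f (x - e1) + f (x + e2) + f (x - e2) + f (x + e3) + f (x - e3) - 6 *\<^sub>R f x"

text \<open>A neighbourhood of \<open>A\<close> that contains all neighbours of points of \<open>A\<close> and the base points of
all triangles with a vertex in \<open>A\<close>. Summation by parts for functions supported in \<open>A\<close> takes place
on \<open>thick A\<close>.\<close>
definition thick :: "(int \<times> int) set \<Rightarrow> (int \<times> int) set" where
  "thick A = (\<lambda>(x, d). x + d) ` (A \<times> ({-1..1} \<times> {-1..1}))"

lemma finite_thick: "finite A \<Longrightarrow> finite (thick A)"
  unfolding thick_def by auto

lemma in_thick: "x \<in> A \<Longrightarrow> y = x + d \<Longrightarrow> \<bar>fst d\<bar> \<le> 1 \<Longrightarrow> \<bar>snd d\<bar> \<le> 1 \<Longrightarrow> y \<in> thick A"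
  unfolding thick_def by (rule image_eqI[of _ _ "(x, d)"]) (auto simp: mem_Times_iff)

lemma sum_shift:
  fixes f :: "int \<times> int \<Rightarrow> 'a::comm_monoid_add"
  assumes "finite Q" and "\<And>x. x \<notin> A \<Longrightarrow> f x = 0" and "A \<subseteq> Q" and "\<And>x. x \<in> A \<Longrightarrow> x - e \<in> Q"
  shows "(\<Sum>x\<in>Q. f (x + e)) = (\<Sum>x\<in>Q. f x)"
proof -
  have "(\<Sum>x\<in>Q. f (x + e)) = (\<Sum>x\<in>(\<lambda>x. x - e) ` A. f (x + e))"
  proof (rule sum.mono_neutral_right)
    show "\<forall>i\<in>Q - (\<lambda>x. x - e) ` A. f (i + e) = 0"
    proof
      fix i assume i: "i \<in> Q - (\<lambda>x. x - e) ` A"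
      have "i + e \<notin> A"
      proof
        assume "i + e \<in> A"
        hence "i + e - e \<in> (\<lambda>x. x - e) ` A" by blast
        thus False using i by simp
      qed
      thus "f (i + e) = 0" by (rule assms(2))
    qed
  qed (use assms in auto)
  also have "\<dots> = (\<Sum>x\<in>A. f x)"
    by (subst sum.reindex) (auto simp: inj_on_def)
  also have "\<dots> = (\<Sum>x\<in>Q. f x)"
    by (rule sum.mono_neutral_left) (use assms in auto)
  finally show ?thesis .
qed

lemma sum_shift_thick:
  fixes f :: "int \<times> int \<Rightarrow> 'a::comm_monoid_add"
  assumes "finite A" and "\<And>x. x \<notin> A \<Longrightarrow> f x = 0" and "\<bar>fst e\<bar> \<le> 1" and "\<bar>snd e\<bar> \<le> 1"
  shows "(\<Sum>x\<in>thick A. f (x + e)) = (\<Sum>x\<in>thick A. f x)"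
    and "(\<Sum>x\<in>thick A. f (x - e)) = (\<Sum>x\<in>thick A. f x)"
proof -
  have sub: "A \<subseteq> thick A"
  proof
    fix x assume "x \<in> A" thus "x \<in> thick A" by (rule in_thick[where d = 0]) auto
  qed
  show "(\<Sum>x\<in>thick A. f (x + e)) = (\<Sum>x\<in>thick A. f x)"
  proof (rule sum_shift[where A = A])
    fix x assume "x \<in> A" thus "x - e \<in> thick A"
      by (rule in_thick[where d = "-e"]) (use assms in auto)
  qed (use assms sub in \<open>auto simp: finite_thick\<close>)
  have "(\<Sum>x\<in>thick A. f (x + (-e))) = (\<Sum>x\<in>thick A. f x)"
  proof (rule sum_shift[where A = A])
    fix x assume "x \<in> A" thus "x - (-e) \<in> thick A"
      by (rule in_thick[where d = "e"]) (use assms in auto)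
  qed (use assms sub in \<open>auto simp: finite_thick\<close>)
  thus "(\<Sum>x\<in>thick A. f (x - e)) = (\<Sum>x\<in>thick A. f x)" by simp
qed

text \<open>The Laplacian is symmetric. Only \<open>p\<close> needs to be finitely supported; \<open>f\<close> is arbitrary.\<close>
lemma sum_mult_lap:
  fixes p f :: "int \<times> int \<Rightarrow> real"
  assumes A: "finite A" and p0: "\<And>x. x \<notin> A \<Longrightarrow> p x = 0"
  shows "(\<Sum>x\<in>thick A. p x * laplace f x) = (\<Sum>x\<in>thick A. laplace p x * f x)"
proof -
  have s: "(\<Sum>x\<in>thick A. p x * f (x + e)) = (\<Sum>x\<in>thick A. p (x - e) * f x)"
          "(\<Sum>x\<in>thick A. p x * f (x - e)) = (\<Sum>x\<in>thick A. p (x + e) * f x)"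
    if "\<bar>fst e\<bar> \<le> 1" "\<bar>snd e\<bar> \<le> 1" for e
    using sum_shift_thick[OF A, of "\<lambda>x. p x * f (x + e)" e] sum_shift_thick[OF A, of "\<lambda>x. p x * f (x - e)" e]
      p0 that by auto
  show ?thesis
    unfolding laplace_def by (simp add: algebra_simps sum.distrib sum_subtractf s sum_distrib_left[symmetric])
qed

lemma dirichlet_form:
  fixes g :: "int \<times> int \<Rightarrow> 'a::real_inner"
  assumes A: "finite A" and g0: "\<And>x. x \<notin> A \<Longrightarrow> g x = 0"
  shows "- (\<Sum>x\<in>thick A. g x \<bullet> laplace g x) =
    (\<Sum>x\<in>thick A. (norm (g (x + e1) - g x))\<^sup>2 + (norm (g (x + e2) - g x))\<^sup>2 + (norm (g (x + e3) - g x))\<^sup>2)"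
proof -
  have s: "(\<Sum>x\<in>thick A. (norm (g (x + e) - g x))\<^sup>2) =
     2 * (\<Sum>x\<in>thick A. g x \<bullet> g x) - (\<Sum>x\<in>thick A. g x \<bullet> g (x + e)) - (\<Sum>x\<in>thick A. g x \<bullet> g (x - e))"
    if e: "\<bar>fst e\<bar> \<le> 1" "\<bar>snd e\<bar> \<le> 1" for e
  proof -
    have "(\<Sum>x\<in>thick A. g (x + e) \<bullet> g (x + e)) = (\<Sum>x\<in>thick A. g x \<bullet> g x)"
      using sum_shift_thick(1)[OF A, of "\<lambda>x. g x \<bullet> g x" e] g0 e by simp
    moreover have "(\<Sum>x\<in>thick A. g x \<bullet> g (x + e)) = (\<Sum>x\<in>thick A. g x \<bullet> g (x - e))"
      using sum_shift_thick(2)[OF A, of "\<lambda>x. g x \<bullet> g (x + e)" e] g0 e by (simp add: inner_commute)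
    ultimately show ?thesis
      by (simp add: power2_norm_eq_inner inner_diff_left inner_diff_right sum.distrib sum_subtractf inner_commute sum_distrib_left[symmetric])
  qed
  show ?thesis
    by (simp add: sum.distrib s laplace_def inner_add_right inner_diff_right sum_subtractf sum_distrib_left[symmetric])
qed

text \<open>A finitely supported function that is harmonic on a set containing its support has
vanishing Dirichlet energy, hence is constant along rows.\<close>
lemma harmonic_zero:
  fixes g :: "int \<times> int \<Rightarrow> 'a::real_inner"
  assumes A: "finite A" and g0: "\<And>x. x \<notin> A \<Longrightarrow> g x = 0" and h: "\<And>x. x \<in> A \<Longrightarrow> laplace g x = 0"
  shows "g x = 0"
proof -
  have "(\<Sum>x\<in>thick A. g x \<bullet> laplace g x) = 0"
  proof (intro sum.neutral ballI)
    fix x show "g x \<bullet> laplace g x = 0" by (cases "x \<in> A") (simp_all add: g0 h)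
  qed
  hence "(\<Sum>x\<in>thick A. (norm (g (x + e1) - g x))\<^sup>2 + (norm (g (x + e2) - g x))\<^sup>2 + (norm (g (x + e3) - g x))\<^sup>2) = 0"
    using dirichlet_form[of A g, OF A g0] by simp
  hence z: "\<forall>x\<in>thick A. (norm (g (x + e1) - g x))\<^sup>2 + (norm (g (x + e2) - g x))\<^sup>2 + (norm (g (x + e3) - g x))\<^sup>2 = 0"
    by (subst (asm) sum_nonneg_eq_0_iff) (use A in \<open>auto simp: finite_thick\<close>)
  have step: "g (x + e1) = g x" for x
  proof (cases "x \<in> A")
    case True
    hence "x \<in> thick A" by (rule in_thick[where d = 0]) auto
    with z have "(norm (g (x + e1) - g x))\<^sup>2 + (norm (g (x + e2) - g x))\<^sup>2 + (norm (g (x + e3) - g x))\<^sup>2 = 0" by blast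
    hence "(norm (g (x + e1) - g x))\<^sup>2 = 0"
      using zero_le_power2[of "norm (g (x + e1) - g x)"] zero_le_power2[of "norm (g (x + e2) - g x)"]
       zero_le_power2[of "norm (g (x + e3) - g x)"] by linarith
    thus ?thesis by simp
  next
    case nA: False
    show ?thesis
    proof (cases "x + e1 \<in> A")
      case True
      hence "x \<in> thick A" by (rule in_thick[where d = "-e1"]) (auto simp: zero_prod_def)
      with z have "(norm (g (x + e1) - g x))\<^sup>2 + (norm (g (x + e2) - g x))\<^sup>2 + (norm (g (x + e3) - g x))\<^sup>2 = 0" by blast
      hence "(norm (g (x + e1) - g x))\<^sup>2 = 0"
        using zero_le_power2[of "norm (g (x + e1) - g x)"] zero_le_power2[of "norm (g (x + e2) - g x)"]
         zero_le_power2[of "norm (g (x + e3) - g x)"] by linarith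
      thus ?thesis by simp
    next
      case False
      thus ?thesis using nA g0 by simp
    qed
  qed
  have shift: "g (x + (int n, 0)) = g x" for n
  proof (induction n)
    case (Suc n)
    have "x + (int (Suc n), 0) = (x + (int n, 0)) + e1" by (simp add: add.assoc)
    thus ?case using step[of "x + (int n, 0)"] Suc by metis
  qed (metis add.right_neutral of_nat_0 zero_prod_def)
  have "inj (\<lambda>n. x + (int n, 0::int))" by (auto simp: inj_def)
  hence "infinite (range (\<lambda>n. x + (int n, 0::int)))" by (rule range_inj_infinite)
  hence "\<not> range (\<lambda>n. x + (int n, 0::int)) \<subseteq> A" using A finite_subset by blast
  then obtain n where "x + (int n, 0) \<notin> A" by blast
  thus ?thesis using shift[of n] g0 by metis
qed

lemma laplace_add: "laplace (\<lambda>x. f x + g x) x = laplace f x + laplace g x"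
  by (simp add: laplace_def algebra_simps)

lemma laplace_mult_left: "laplace (\<lambda>x. c * f x) x = c * laplace f x" for f :: "int \<times> int \<Rightarrow> complex"
  by (simp add: laplace_def algebra_simps scaleR_conv_of_real)

text \<open>Poisson's equation on a finite set, with zero values outside, is solved by adding one point \<open>a\<close> at a time. The correction \<open>K\<close>
is harmonic on the old set and supported on the new one; its Laplacian at \<open>a\<close> is nonzero, for otherwise
\<open>K\<close> would vanish although \<open>K a = 1\<close>.\<close>
lemma poisson_solvable:
  fixes f :: "int \<times> int \<Rightarrow> complex"
  assumes "finite A"
  shows "\<exists>g. (\<forall>x. x \<notin> A \<longrightarrow> g x = 0) \<and> (\<forall>x\<in>A. laplace g x = f x)"
  using assms
proof (induction A arbitrary: f rule: finite_induct)
  case empty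
  show ?case by (rule exI[of _ "\<lambda>_. 0"]) auto
next
  case (insert a A)
  obtain g1 where g1: "\<And>x. x \<notin> A \<Longrightarrow> g1 x = 0" "\<And>x. x \<in> A \<Longrightarrow> laplace g1 x = f x"
    using insert.IH[of f] by blast
  define dl :: "int \<times> int \<Rightarrow> complex" where "dl x = (if x = a then 1 else 0)" for x
  obtain g2 where g2: "\<And>x. x \<notin> A \<Longrightarrow> g2 x = 0" "\<And>x. x \<in> A \<Longrightarrow> laplace g2 x = - laplace dl x"
    using insert.IH[of "\<lambda>x. - laplace dl x"] by blast
  define K where "K x = dl x + g2 x" for x
  have K0: "x \<notin> insert a A \<Longrightarrow> K x = 0" for x by (simp add: K_def dl_def g2)
  have lK: "laplace K x = laplace dl x + laplace g2 x" for x unfolding K_def by (rule laplace_add)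
  have KA: "x \<in> A \<Longrightarrow> laplace K x = 0" for x by (simp add: lK g2)
  have Ka: "laplace K a \<noteq> 0"
  proof
    assume "laplace K a = 0"
    hence "K a = 0"
      using harmonic_zero[of "insert a A" K a] K0 KA insert.hyps by blast
    thus False using insert.hyps by (simp add: K_def dl_def g2)
  qed
  define c where "c = (f a - laplace g1 a) / laplace K a"
  define g where "g x = g1 x + c * K x" for x
  have lg: "laplace g x = laplace g1 x + c * laplace K x" for x
    unfolding g_def by (simp add: laplace_add laplace_mult_left)
  show ?case
  proof (intro exI[of _ g] conjI allI impI ballI)
    fix x assume "x \<notin> insert a A" thus "g x = 0" using K0 g1 by (simp add: g_def)
  next
    fix x assume "x \<in> insert a A"
    then consider "x = a" | "x \<in> A" by blast
    thus "laplace g x = f x"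
    proof cases
      case 1 thus ?thesis using Ka by (simp add: lg c_def)
    next
      case 2 thus ?thesis by (simp add: lg KA g1)
    qed
  qed
qed

section \<open>Equilateral defect and harmonic replacement\<close>

text \<open>The primitive cube root of unity with positive imaginary part.\<close>
definition omega :: complex where "omega = Complex (-1/2) (sqrt 3 / 2)"

text \<open>The defects of the two triangles of the lattice cell with lower left corner \<open>y\<close>. Their
vertices are listed anticlockwise, starting from \<open>y\<close> for the upward triangle and from the opposite corner
\<open>y + (1, 1)\<close> for the downward one. A defect vanishes exactly if the image of the triangle is a positively
oriented equilateral triangle or a point. These are discrete versions of the derivative with
respect to the conjugate variable.\<close>
definition up_defect :: "(int \<times> int \<Rightarrow> complex) \<Rightarrow> int \<times> int \<Rightarrow> complex" where
  "up_defect U y = U y + omega * U (y + e1) + omega\<^sup>2 * U (y + e2)"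
definition down_defect :: "(int \<times> int \<Rightarrow> complex) \<Rightarrow> int \<times> int \<Rightarrow> complex" where
  "down_defect U y = U (y + (1, 1)) + omega * U (y + e2) + omega\<^sup>2 * U (y + e1)"

lemma omega_sq: "omega\<^sup>2 = - 1 - omega"
  by (simp add: omega_def power2_eq_square complex_eq_iff)

lemma inner_om: "(omega * a) \<bullet> b = a \<bullet> ((- 1 - omega) * b)" "((- 1 - omega) * a) \<bullet> b = a \<bullet> (omega * b)"
  by (simp_all add: inner_complex_def omega_def algebra_simps)

lemma omega_cube: "omega * (omega * z) = - z - omega * z"
proof -
  have "omega * (omega * z) = omega\<^sup>2 * z" by (simp add: power2_eq_square)
  thus ?thesis unfolding omega_sq by (simp add: algebra_simps)
qed

text \<open>Discrete counterpart of the factorisation of the Laplacian into the two complex derivatives: the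
six triangles around \<open>x\<close>, each with its defect based at \<open>x\<close>, add up to \<open>- laplace U x\<close>.\<close>
lemma laplace_conv_triangles:
  "- laplace U x = up_defect U x + omega\<^sup>2 * up_defect U (x - e1) + omega * up_defect U (x - e2)
     + down_defect U (x - (1, 1)) + omega\<^sup>2 * down_defect U (x - e2) + omega * down_defect U (x - e1)"
  by (cases x) (simp add: laplace_def up_defect_def down_defect_def omega_sq omega_cube algebra_simps scaleR_conv_of_real)

text \<open>Testing the Laplacian of \<open>U\<close> with a finitely supported \<open>g\<close> only sees the defects of both functions.
For \<open>U = g\<close> this says that the defects carry the whole Dirichlet energy of \<open>g\<close>.\<close>
lemma sum_inner_lap:
  fixes g U :: "int \<times> int \<Rightarrow> complex"
  assumes A: "finite A" and g0: "\<And>x. x \<notin> A \<Longrightarrow> g x = 0"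
  shows "- (\<Sum>x\<in>thick A. g x \<bullet> laplace U x) =
    (\<Sum>x\<in>thick A. up_defect g x \<bullet> up_defect U x + down_defect g x \<bullet> down_defect U x)"
proof -
  have s: "(\<Sum>x\<in>thick A. g x \<bullet> f (x - e)) = (\<Sum>x\<in>thick A. g (x + e) \<bullet> f x)"
    if "\<bar>fst e\<bar> \<le> 1" "\<bar>snd e\<bar> \<le> 1" for e and f :: "int \<times> int \<Rightarrow> complex"
    using sum_shift_thick(1)[OF A, of "\<lambda>x. g x \<bullet> f (x - e)" e] g0 that by auto
  have "- (\<Sum>x\<in>thick A. g x \<bullet> laplace U x) = (\<Sum>x\<in>thick A. g x \<bullet> (- laplace U x))"
    by (simp add: sum_negf)
  also have "\<dots> = (\<Sum>x\<in>thick A. g x \<bullet> up_defect U x) + (\<Sum>x\<in>thick A. g x \<bullet> (omega\<^sup>2 * up_defect U (x - e1)))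
      + (\<Sum>x\<in>thick A. g x \<bullet> (omega * up_defect U (x - e2))) + (\<Sum>x\<in>thick A. g x \<bullet> down_defect U (x - (1,1)))
      + (\<Sum>x\<in>thick A. g x \<bullet> (omega\<^sup>2 * down_defect U (x - e2))) + (\<Sum>x\<in>thick A. g x \<bullet> (omega * down_defect U (x - e1)))"
    unfolding laplace_conv_triangles by (simp only: inner_add_right sum.distrib)
  also have "\<dots> = (\<Sum>x\<in>thick A. g x \<bullet> up_defect U x) + (\<Sum>x\<in>thick A. g (x + e1) \<bullet> (omega\<^sup>2 * up_defect U x))
      + (\<Sum>x\<in>thick A. g (x + e2) \<bullet> (omega * up_defect U x)) + (\<Sum>x\<in>thick A. g (x + (1,1)) \<bullet> down_defect U x)
      + (\<Sum>x\<in>thick A. g (x + e2) \<bullet> (omega\<^sup>2 * down_defect U x)) + (\<Sum>x\<in>thick A. g (x + e1) \<bullet> (omega * down_defect U x))"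
    using s[of e1 "\<lambda>x. omega\<^sup>2 * up_defect U x"] s[of e2 "\<lambda>x. omega * up_defect U x"] s[of "(1,1)" "down_defect U"]
      s[of e2 "\<lambda>x. omega\<^sup>2 * down_defect U x"] s[of e1 "\<lambda>x. omega * down_defect U x"] by simp
  also have "\<dots> = (\<Sum>x\<in>thick A. up_defect g x \<bullet> up_defect U x + down_defect g x \<bullet> down_defect U x)"
    unfolding sum.distrib[symmetric]
  proof (rule sum.cong[OF refl])
    fix x
    have "up_defect g x \<bullet> z = g x \<bullet> z + g (x + e1) \<bullet> (omega\<^sup>2 * z) + g (x + e2) \<bullet> (omega * z)" for z
      unfolding up_defect_def omega_sq inner_add_left inner_om by simp
    moreover have "down_defect g x \<bullet> z = g (x + (1,1)) \<bullet> z + g (x + e2) \<bullet> (omega\<^sup>2 * z) + g (x + e1) \<bullet> (omega * z)" for z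
      unfolding down_defect_def omega_sq inner_add_left inner_om by simp
    ultimately show "g x \<bullet> up_defect U x + g (x + e1) \<bullet> (omega\<^sup>2 * up_defect U x) + g (x + e2) \<bullet> (omega * up_defect U x) +
         g (x + (1, 1)) \<bullet> down_defect U x + g (x + e2) \<bullet> (omega\<^sup>2 * down_defect U x) + g (x + e1) \<bullet> (omega * down_defect U x) =
         up_defect g x \<bullet> up_defect U x + down_defect g x \<bullet> down_defect U x" by simp
  qed
  finally show ?thesis .
qed

text \<open>If \<open>g\<close> is supported in \<open>A\<close> and has the same Laplacian as \<open>U\<close> there, so that \<open>U - g\<close> is the harmonic
replacement of \<open>U\<close>, then its energy is at most the sum of the squared defects of \<open>U\<close>.\<close>
lemma replacement_estimate:
  fixes g U :: "int \<times> int \<Rightarrow> complex"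
  assumes A: "finite A" and g0: "\<And>x. x \<notin> A \<Longrightarrow> g x = 0" and lg: "\<And>x. x \<in> A \<Longrightarrow> laplace g x = laplace U x"
  shows "(\<Sum>x\<in>thick A. (norm (g (x + e2) - g x))\<^sup>2) \<le> (\<Sum>x\<in>thick A. (norm (up_defect U x))\<^sup>2 + (norm (down_defect U x))\<^sup>2)"
proof -
  have eq: "(\<Sum>x\<in>thick A. g x \<bullet> laplace g x) = (\<Sum>x\<in>thick A. g x \<bullet> laplace U x)"
  proof (rule sum.cong[OF refl])
    fix x show "g x \<bullet> laplace g x = g x \<bullet> laplace U x" by (cases "x \<in> A") (simp_all add: g0 lg)
  qed
  define S where "S = (\<Sum>x\<in>thick A. (norm (up_defect g x))\<^sup>2 + (norm (down_defect g x))\<^sup>2)"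
  have S: "S = - (\<Sum>x\<in>thick A. g x \<bullet> laplace g x)"
    using sum_inner_lap[of A g g, OF A g0] by (simp add: S_def power2_norm_eq_inner)
  have S': "S = (\<Sum>x\<in>thick A. up_defect g x \<bullet> up_defect U x + down_defect g x \<bullet> down_defect U x)"
    using sum_inner_lap[of A g U, OF A g0] by (simp add: S eq)
  have "S \<le> (\<Sum>x\<in>thick A. ((norm (up_defect g x))\<^sup>2 + (norm (down_defect g x))\<^sup>2)/2 + ((norm (up_defect U x))\<^sup>2 + (norm (down_defect U x))\<^sup>2)/2)"
    unfolding S'
  proof (rule sum_mono)
    fix x
    have ab: "a \<bullet> b \<le> ((norm a)\<^sup>2 + (norm b)\<^sup>2) / 2" for a b :: complex
      using zero_le_power2[of "norm (a - b)"]
      by (simp add: power2_norm_eq_inner inner_diff_left inner_diff_right inner_commute)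
    show "up_defect g x \<bullet> up_defect U x + down_defect g x \<bullet> down_defect U x \<le> ((norm (up_defect g x))\<^sup>2 + (norm (down_defect g x))\<^sup>2)/2 + ((norm (up_defect U x))\<^sup>2 + (norm (down_defect U x))\<^sup>2)/2"
      using ab[of "up_defect g x" "up_defect U x"] ab[of "down_defect g x" "down_defect U x"] by argo
  qed
  hence "S \<le> S / 2 + (\<Sum>x\<in>thick A. (norm (up_defect U x))\<^sup>2 + (norm (down_defect U x))\<^sup>2) / 2"
    by (simp only: sum.distrib sum_divide_distrib[symmetric] S_def)
  hence "S \<le> (\<Sum>x\<in>thick A. (norm (up_defect U x))\<^sup>2 + (norm (down_defect U x))\<^sup>2)" by argo
  moreover have "(\<Sum>x\<in>thick A. (norm (g (x + e2) - g x))\<^sup>2) \<le> S"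
  proof -
    have "S = (\<Sum>x\<in>thick A. (norm (g (x + e1) - g x))\<^sup>2 + (norm (g (x + e2) - g x))\<^sup>2 + (norm (g (x + e3) - g x))\<^sup>2)"
      using dirichlet_form[of A g, OF A g0] by (simp add: S)
    thus ?thesis by (simp only:) (rule sum_mono, simp)
  qed
  ultimately show ?thesis by linarith
qed

text \<open>Twice the signed area of the triangle spanned by two vectors of the plane.\<close>
definition cross2 :: "complex \<Rightarrow> complex \<Rightarrow> real" where
  "cross2 p q = Re p * Im q - Im p * Re q"

text \<open>With \<open>x, y, z\<close> the side lengths, \<open>S = x\<^sup>2 + y\<^sup>2 + z\<^sup>2\<close> and \<open>s\<close> twice the signed area, the squared defect is
\<open>N = S / 2 - sqrt 3 s\<close>. Its product with \<open>S / 2 + sqrt 3 s\<close> is a quadratic form in the differences of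
the squared side lengths by Heron's formula, and \<open>s > 0\<close> bounds the second factor below by \<open>S / 2\<close>.\<close>
lemma equilateral_defect:
  fixes p q r :: complex
  assumes pos: "cross2 (q - p) (r - p) > 0"
  shows "(norm (p + omega * q + omega\<^sup>2 * r))\<^sup>2 \<le>
    6 * ((norm (q - p) - \<mu>)\<^sup>2 + (norm (r - p) - \<mu>)\<^sup>2 + (norm (r - q) - \<mu>)\<^sup>2)"
proof -
  define P Q where "P = q - p" and "Q = r - p"
  define x y z where "x = norm P" and "y = norm Q" and "z = norm (r - q)"
  define s where "s = cross2 P Q"
  define N where "N = (norm (p + omega * q + omega\<^sup>2 * r))\<^sup>2"
  define S where "S = x\<^sup>2 + y\<^sup>2 + z\<^sup>2"
  have s: "s > 0" using pos by (simp add: s_def P_def Q_def)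
  have rq: "r - q = Q - P" by (simp add: P_def Q_def)
  have xs: "x\<^sup>2 = (Re P)\<^sup>2 + (Im P)\<^sup>2" "y\<^sup>2 = (Re Q)\<^sup>2 + (Im Q)\<^sup>2" "z\<^sup>2 = (Re Q - Re P)\<^sup>2 + (Im Q - Im P)\<^sup>2"
    by (simp_all add: x_def y_def z_def rq cmod_power2)
  have pr: "p + omega * q + omega\<^sup>2 * r = omega * P + omega\<^sup>2 * Q"
    unfolding P_def Q_def omega_sq by (simp add: algebra_simps)
  have s3: "sqrt 3 * (sqrt 3 * a) = 3 * a" for a
    by (simp flip: mult.assoc)
  have N: "N = S / 2 - sqrt 3 * s"
    unfolding N_def pr unfolding omega_sq S_def xs s_def cross2_def cmod_power2
    by (simp add: omega_def power2_eq_square algebra_simps s3 add_divide_distrib diff_divide_distrib)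
  have s2: "s\<^sup>2 = x\<^sup>2 * y\<^sup>2 - (x\<^sup>2 + y\<^sup>2 - z\<^sup>2)\<^sup>2 / 4"
    unfolding xs s_def cross2_def by (simp add: power2_eq_square algebra_simps) 
  have prod: "N * (S / 2 + sqrt 3 * s) = ((x\<^sup>2 - y\<^sup>2)\<^sup>2 + (y\<^sup>2 - z\<^sup>2)\<^sup>2 + (z\<^sup>2 - x\<^sup>2)\<^sup>2) / 2"
  proof -
    have "N * (S / 2 + sqrt 3 * s) = S\<^sup>2 / 4 - 3 * s\<^sup>2"
      unfolding N by (simp add: power2_eq_square algebra_simps s3)
    also have "\<dots> = ((x\<^sup>2 - y\<^sup>2)\<^sup>2 + (y\<^sup>2 - z\<^sup>2)\<^sup>2 + (z\<^sup>2 - x\<^sup>2)\<^sup>2) / 2"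
      unfolding s2 S_def by (simp add: power2_eq_square algebra_simps add_divide_distrib diff_divide_distrib)
    finally show ?thesis .
  qed
  have S0: "S > 0"
  proof -
    have "P \<noteq> 0" using s by (auto simp: s_def cross2_def)
    hence "x\<^sup>2 > 0" by (simp add: x_def)
    thus ?thesis unfolding S_def using zero_le_power2[of y] zero_le_power2[of z] by linarith
  qed
  have sq: "(a\<^sup>2 - b\<^sup>2)\<^sup>2 \<le> 2 * S * (a - b)\<^sup>2" if "a\<^sup>2 + b\<^sup>2 \<le> S" for a b
  proof -
    have "(a\<^sup>2 - b\<^sup>2)\<^sup>2 = (a + b)\<^sup>2 * (a - b)\<^sup>2" by (simp add: power2_eq_square algebra_simps)
    also have "(a + b)\<^sup>2 \<le> 2 * S"
      using that zero_le_power2[of "a - b"] by (simp add: power2_eq_square algebra_simps)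
    hence "(a + b)\<^sup>2 * (a - b)\<^sup>2 \<le> 2 * S * (a - b)\<^sup>2" by (rule mult_right_mono) simp
    finally show ?thesis .
  qed
  have "N * (S / 2) \<le> N * (S / 2 + sqrt 3 * s)"
    by (rule mult_left_mono) (use s in \<open>auto simp: N_def\<close>)
  also have "\<dots> \<le> (2 * S * (x - y)\<^sup>2 + 2 * S * (y - z)\<^sup>2 + 2 * S * (z - x)\<^sup>2) / 2"
    unfolding prod using sq[of x y] sq[of y z] sq[of z x] by (simp add: S_def)
  also have "\<dots> = (2 * ((x - y)\<^sup>2 + (y - z)\<^sup>2 + (z - x)\<^sup>2)) * (S / 2)" by (simp add: algebra_simps)
  finally have "N \<le> 2 * ((x - y)\<^sup>2 + (y - z)\<^sup>2 + (z - x)\<^sup>2)"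
    using S0 by (simp add: mult_le_cancel_right)
  also have "\<dots> \<le> 6 * ((x - \<mu>)\<^sup>2 + (y - \<mu>)\<^sup>2 + (z - \<mu>)\<^sup>2)"
    using zero_le_power2[of "(x - \<mu>) + (y - \<mu>) + (z - \<mu>)"] by (simp add: power2_eq_square algebra_simps)
  finally show ?thesis unfolding N_def x_def y_def z_def P_def Q_def .
qed

lemma thick_box: "thick ({a..b} \<times> {c..d}) \<subseteq> {a - 1..b + 1} \<times> {c - 1..d + 1}"
  by (auto simp: thick_def)

section \<open>The test function\<close>

text \<open>A parabola truncated to \<open>0 \<le> t \<le> 4 m\<close>. Its square \<open>bump\<close> is the discrete analogue of a compactly
supported function with bounded second derivative: the height is of order \<open>m ^ 4\<close>, the first and
second differences are of order \<open>m ^ 3\<close> and \<open>m ^ 2\<close>, also across the ends of the support.\<close>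
definition parabola :: "int \<Rightarrow> int \<Rightarrow> int" where
  "parabola m t = (if 0 \<le> t \<and> t \<le> 4 * m then t * (4 * m - t) else 0)"

lemma parabola_bounds:
  assumes "1 \<le> m"
  shows "0 \<le> parabola m t" and "parabola m t \<le> 4 * m\<^sup>2"
proof -
  show "0 \<le> parabola m t" by (simp add: parabola_def)
  have "4 * m\<^sup>2 - t * (4 * m - t) = (t - 2 * m)\<^sup>2" by (simp add: power2_eq_square algebra_simps)
  hence "t * (4 * m - t) \<le> 4 * m\<^sup>2" using zero_le_power2[of "t - 2 * m"] by linarith
  thus "parabola m t \<le> 4 * m\<^sup>2" by (simp add: parabola_def)
qed

lemma parabola_step:
  assumes "1 \<le> m"
  shows "\<bar>parabola m (t + 1) - parabola m t\<bar> \<le> 4 * m"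
proof -
  consider "t + 1 \<le> 0 \<or> 4 * m \<le> t" | "0 \<le> t" "t + 1 \<le> 4 * m" by linarith
  thus ?thesis
  proof cases
    case 1
    have "parabola m (t + 1) = 0" "parabola m t = 0" using 1 by (auto simp: parabola_def)
    thus ?thesis using assms by simp
  next
    case 2
    have "parabola m (t + 1) - parabola m t = 4 * m - 2 * t - 1" using 2 by (simp add: parabola_def algebra_simps)
    thus ?thesis using 2 by linarith
  qed
qed

text \<open>The test function in one variable.\<close>
definition bump :: "int \<Rightarrow> int \<Rightarrow> real" where
  "bump m t = (of_int (parabola m t))\<^sup>2"

lemma bump_nonneg: "0 \<le> bump m t"
  by (simp add: bump_def)

lemma bump_zero: "t \<le> 0 \<or> 4 * m \<le> t \<Longrightarrow> bump m t = 0"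
  by (auto simp: bump_def parabola_def)

lemma bump_le:
  assumes "1 \<le> m" shows "bump m t \<le> 16 * of_int m ^ 4"
proof -
  have "(parabola m t)\<^sup>2 \<le> (4 * m\<^sup>2)\<^sup>2" by (intro power_mono parabola_bounds assms)
  hence "(parabola m t)\<^sup>2 \<le> 16 * m ^ 4" by (simp add: power_mult_distrib flip: power_mult)
  hence "real_of_int ((parabola m t)\<^sup>2) \<le> real_of_int (16 * m ^ 4)" by (simp only: of_int_le_iff)
  thus ?thesis by (simp add: bump_def)
qed

lemma bump_step:
  assumes "1 \<le> m" shows "\<bar>bump m (t + 1) - bump m t\<bar> \<le> 32 * of_int m ^ 3"
proof -
  have "\<bar>(parabola m (t + 1))\<^sup>2 - (parabola m t)\<^sup>2\<bar> = \<bar>parabola m (t + 1) - parabola m t\<bar> * (parabola m (t + 1) + parabola m t)"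
  proof -
    have "(parabola m (t + 1))\<^sup>2 - (parabola m t)\<^sup>2 = (parabola m (t + 1) - parabola m t) * (parabola m (t + 1) + parabola m t)"
      by (simp add: power2_eq_square algebra_simps)
    thus ?thesis using parabola_bounds[OF assms, of t] parabola_bounds[OF assms, of "t+1"] by (simp add: abs_mult)
  qed
  also have "\<dots> \<le> (4 * m) * (8 * m\<^sup>2)"
    by (rule mult_mono) (use parabola_step[OF assms, of t] parabola_bounds[OF assms, of t] parabola_bounds[OF assms, of "t+1"] assms in linarith)+
  also have "\<dots> = 32 * m ^ 3" by (simp add: power2_eq_square power3_eq_cube)
  finally have "real_of_int \<bar>(parabola m (t + 1))\<^sup>2 - (parabola m t)\<^sup>2\<bar> \<le> real_of_int (32 * m ^ 3)" by (simp only: of_int_le_iff)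
  thus ?thesis by (simp add: bump_def)
qed

lemma bump_second:
  assumes "1 \<le> m" shows "\<bar>bump m (t + 1) + bump m (t - 1) - 2 * bump m t\<bar> \<le> 32 * of_int m ^ 2"
proof -
  define P dp dm where "P = parabola m t" and "dp = parabola m (t + 1) - P" and "dm = parabola m (t - 1) - P"
  have abs: "\<bar>dp\<bar> \<le> 4 * m" "\<bar>dm\<bar> \<le> 4 * m"
    using parabola_step[OF assms, of t] parabola_step[OF assms, of "t - 1"] by (auto simp: P_def dp_def dm_def)
  have sq: "x\<^sup>2 \<le> 16 * m\<^sup>2" if "\<bar>x\<bar> \<le> 4 * m" for x
  proof -
    have "\<bar>x\<bar>\<^sup>2 \<le> (4 * m)\<^sup>2" by (rule power_mono[OF that]) simp
    thus ?thesis by (simp add: power_mult_distrib)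
  qed
  have e: "(parabola m (t + 1))\<^sup>2 + (parabola m (t - 1))\<^sup>2 - 2 * P\<^sup>2 = 2 * P * (dp + dm) + dp\<^sup>2 + dm\<^sup>2"
    by (simp add: dp_def dm_def power2_eq_square algebra_simps)
  have "2 * P * (dp + dm) = 0 \<or> 2 * P * (dp + dm) = - 4 * P"
  proof -
    have "P = 0 \<or> dp + dm = -2"
    proof (cases "0 < t \<and> t < 4 * m")
      case True
      hence "dp + dm = -2" by (simp add: P_def dp_def dm_def parabola_def algebra_simps)
      thus ?thesis ..
    next
      case False
      hence "P = 0" by (auto simp: P_def parabola_def)
      thus ?thesis ..
    qed
    thus ?thesis by auto
  qed
  hence "- 16 * m\<^sup>2 \<le> 2 * P * (dp + dm)" "2 * P * (dp + dm) \<le> 0"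
    using parabola_bounds[OF assms, of t] by (auto simp: P_def)
  hence "\<bar>(parabola m (t + 1))\<^sup>2 + (parabola m (t - 1))\<^sup>2 - 2 * P\<^sup>2\<bar> \<le> 32 * m\<^sup>2"
    unfolding e using sq[OF abs(1)] sq[OF abs(2)] zero_le_power2[of dp] zero_le_power2[of dm] zero_le_power2[of m] by linarith
  hence "real_of_int \<bar>(parabola m (t + 1))\<^sup>2 + (parabola m (t - 1))\<^sup>2 - 2 * P\<^sup>2\<bar> \<le> real_of_int (32 * m\<^sup>2)"
    by (simp only: of_int_le_iff)
  thus ?thesis by (simp add: bump_def P_def)
qed

text \<open>At three quarters of its support the bump decreases at the maximal order.\<close>
lemma bump_descent:
  assumes "1 \<le> m" shows "bump m (3 * m) - bump m (3 * m - 1) \<le> - 6 * of_int m ^ 3"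
proof -
  have p: "parabola m (3 * m) = 3 * m\<^sup>2" "parabola m (3 * m - 1) = 3 * m\<^sup>2 + (2 * m - 1)"
    using assms by (simp_all add: parabola_def power2_eq_square algebra_simps)
  have "(parabola m (3 * m - 1))\<^sup>2 - (parabola m (3 * m))\<^sup>2 = (2 * m - 1) * (6 * m\<^sup>2 + (2 * m - 1))"
    unfolding p by (simp add: power2_eq_square algebra_simps)
  also have "\<dots> \<ge> m * (6 * m\<^sup>2)"
    by (rule mult_mono) (use assms in auto)
  also have "m * (6 * m\<^sup>2) = 6 * m ^ 3" by (simp add: power2_eq_square power3_eq_cube)
  finally have "real_of_int (6 * m ^ 3) \<le> real_of_int ((parabola m (3 * m - 1))\<^sup>2 - (parabola m (3 * m))\<^sup>2)"
    by (simp only: of_int_le_iff)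
  thus ?thesis by (simp add: bump_def)
qed

lemma bump_sum:
  assumes "1 \<le> m" shows "18 * of_int m ^ 5 \<le> (\<Sum>t\<in>{0..4 * m}. bump m t)"
proof -
  have m: "real_of_int m \<ge> 1" using assms by simp
  have "18 * real_of_int m ^ 5 \<le> of_nat (card {m..3*m}) * (9 * of_int m ^ 4)"
    using assms by (simp add: algebra_simps eval_nat_numeral)
  also have "\<dots> \<le> (\<Sum>t\<in>{m..3*m}. bump m t)"
  proof (rule sum_bounded_below)
    fix t assume t: "t \<in> {m..3*m}"
    have "0 \<le> (t - m) * (3 * m - t)" using t by simp
    hence "3 * m\<^sup>2 \<le> t * (4 * m - t)" by (simp add: power2_eq_square algebra_simps)
    hence "3 * m\<^sup>2 \<le> parabola m t" using t assms by (simp add: parabola_def)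
    hence "(3 * m\<^sup>2)\<^sup>2 \<le> (parabola m t)\<^sup>2" by (rule power_mono) simp
    hence "9 * m ^ 4 \<le> (parabola m t)\<^sup>2" by (simp add: power_mult_distrib flip: power_mult)
    hence "real_of_int (9 * m ^ 4) \<le> real_of_int ((parabola m t)\<^sup>2)" by (simp only: of_int_le_iff)
    thus "9 * of_int m ^ 4 \<le> bump m t" by (simp add: bump_def)
  qed
  also have "\<dots> \<le> (\<Sum>t\<in>{0..4 * m}. bump m t)"
    by (rule sum_mono2) (use assms in \<open>auto simp: bump_nonneg\<close>)
  finally show ?thesis .
qed

lemma laplace_product_bound:
  fixes a b :: "int \<Rightarrow> real"
  assumes "\<And>t. 0 \<le> a t" "\<And>t. a t \<le> A0" "\<And>t. \<bar>a (t + 1) - a t\<bar> \<le> A1" "\<And>t. \<bar>a (t + 1) + a (t - 1) - 2 * a t\<bar> \<le> A2"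
  assumes "\<And>t. 0 \<le> b t" "\<And>t. b t \<le> A0" "\<And>t. \<bar>b (t + 1) - b t\<bar> \<le> A1" "\<And>t. \<bar>b (t + 1) + b (t - 1) - 2 * b t\<bar> \<le> A2"
  shows "\<bar>laplace (\<lambda>x. a (fst x) * b (snd x)) y\<bar> \<le> 4 * A0 * A2 + 2 * A1\<^sup>2"
proof -
  obtain s t where y: "y = (s, t)" by (cases y)
  define da db where "da = a (s + 1) + a (s - 1) - 2 * a s" and "db = b (t + 1) + b (t - 1) - 2 * b t"
  have eq: "laplace (\<lambda>x. a (fst x) * b (snd x)) y = 2 * (b t * da) + 2 * (a s * db)
     + (a (s + 1) - a s) * (b (t - 1) - b t) + (a (s - 1) - a s) * (b (t + 1) - b t)"
    by (simp add: laplace_def y da_def db_def algebra_simps)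
  have 1: "\<bar>b t * da\<bar> \<le> A0 * A2" "\<bar>a s * db\<bar> \<le> A0 * A2"
    unfolding abs_mult da_def db_def by (rule mult_mono; use assms order_trans[OF assms(1,2)] in force)+
  have st: "\<bar>a (s - 1) - a s\<bar> \<le> A1" "\<bar>b (t - 1) - b t\<bar> \<le> A1"
    using assms(3)[of "s - 1"] assms(7)[of "t - 1"] by (simp_all add: abs_minus_commute)
  have 2: "\<bar>(a (s + 1) - a s) * (b (t - 1) - b t)\<bar> \<le> A1\<^sup>2" "\<bar>(a (s - 1) - a s) * (b (t + 1) - b t)\<bar> \<le> A1\<^sup>2"
    unfolding abs_mult power2_eq_square by (rule mult_mono; use assms st order_trans[OF abs_ge_zero st(1)] in force)+
  show ?thesis unfolding eq using 1 2 by linarith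
qed

text \<open>The squared norm of a harmonic function is subharmonic.\<close>
lemma laplace_norm_sq:
  fixes d :: "int \<times> int \<Rightarrow> 'a::real_inner"
  assumes "laplace d x = 0"
  shows "0 \<le> laplace (\<lambda>x. (norm (d x))\<^sup>2) x"
proof -
  have a: "(norm y)\<^sup>2 = (norm (y - d x))\<^sup>2 + 2 * (d x \<bullet> y) - (norm (d x))\<^sup>2" for y
    by (simp add: power2_norm_eq_inner inner_diff_left inner_diff_right inner_commute)
  have "laplace (\<lambda>x. (norm (d x))\<^sup>2) x =
     (norm (d (x + e1) - d x))\<^sup>2 + (norm (d (x - e1) - d x))\<^sup>2 + (norm (d (x + e2) - d x))\<^sup>2
     + (norm (d (x - e2) - d x))\<^sup>2 + (norm (d (x + e3) - d x))\<^sup>2 + (norm (d (x - e3) - d x))\<^sup>2 + 2 * (d x \<bullet> laplace d x)"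
    unfolding laplace_def a[of "d (x + e1)"] a[of "d (x - e1)"] a[of "d (x + e2)"] a[of "d (x - e2)"] a[of "d (x + e3)"] a[of "d (x - e3)"]
    by (simp add: inner_add_right inner_diff_right power2_norm_eq_inner algebra_simps)
  thus ?thesis by (simp add: assms)
qed

section \<open>Energy of a deformation near the interface\<close>

text \<open>The differences between nearest neighbours.\<close>
definition hexdirs :: "(int \<times> int) set" where
  "hexdirs = {(1,0), (-1,0), (0,1), (0,-1), (1,-1), (-1,1)}"

text \<open>The rest length of the bonds starting at \<open>x\<close>, as ordered pairs.\<close>
definition rest_length :: "real \<Rightarrow> int \<times> int \<Rightarrow> real" where
  "rest_length lam x = (if fst x < 0 then 1 else lam)"

text \<open>The energy of the six bonds starting at \<open>x\<close>.\<close>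
definition star_energy :: "real \<Rightarrow> (int \<times> int \<Rightarrow> 'a::real_normed_vector) \<Rightarrow> int \<times> int \<Rightarrow> real" where
  "star_energy lam U x = (\<Sum>e\<in>hexdirs. (norm (U x - U (x + e)) - rest_length lam x)\<^sup>2)"

lemma star_energy_nonneg: "0 \<le> star_energy lam U x"
  unfolding star_energy_def by (rule sum_nonneg) simp

lemma star_energy_ge: "e \<in> hexdirs \<Longrightarrow> (norm (U x - U (x + e)) - rest_length lam x)\<^sup>2 \<le> star_energy lam U x"
  unfolding star_energy_def by (rule member_le_sum) (auto simp: hexdirs_def)

lemma star_energy_ge2:
  assumes "e \<in> hexdirs" "f \<in> hexdirs" "e \<noteq> f"
  shows "(norm (U x - U (x + e)) - rest_length lam x)\<^sup>2 + (norm (U x - U (x + f)) - rest_length lam x)\<^sup>2 \<le> star_energy lam U x"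
proof -
  have "(\<Sum>e\<in>{e, f}. (norm (U x - U (x + e)) - rest_length lam x)\<^sup>2) \<le> star_energy lam U x"
    unfolding star_energy_def by (rule sum_mono2) (use assms in \<open>auto simp: hexdirs_def\<close>)
  thus ?thesis using assms by simp
qed

text \<open>The two triangles of the cell at \<open>y\<close> are mapped with positive orientation.\<close>
definition oriented_at :: "(int \<times> int \<Rightarrow> complex) \<Rightarrow> int \<times> int \<Rightarrow> bool" where
  "oriented_at U y \<longleftrightarrow> cross2 (U (y + e1) - U y) (U (y + e2) - U y) > 0 \<and>
     cross2 (U (y + e2) - U (y + (1, 1))) (U (y + e1) - U (y + (1, 1))) > 0"

text \<open>The three bonds of a triangle can be oriented such that they start in one and the same half of
the lattice, hence have the same rest length: the upward triangle uses the half of \<open>y\<close>, the downward one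
that of \<open>y + e1\<close>.\<close>
lemma triangles_le_star:
  fixes U :: "int \<times> int \<Rightarrow> complex"
  assumes "oriented_at U y"
  shows "(norm (up_defect U y))\<^sup>2 + (norm (down_defect U y))\<^sup>2 \<le>
     6 * (star_energy lam U y + star_energy lam U (y + e2) + star_energy lam U (y + e1) + star_energy lam U (y + (1, 1)))"
proof -
  obtain s t where y: "y = (s, t)" by (cases y)
  have "(norm (up_defect U y))\<^sup>2 \<le> 6 * ((norm (U (y + e1) - U y) - rest_length lam y)\<^sup>2 + (norm (U (y + e2) - U y) - rest_length lam y)\<^sup>2
      + (norm (U (y + e2) - U (y + e1)) - rest_length lam y)\<^sup>2)"
    unfolding up_defect_def by (rule equilateral_defect) (use assms in \<open>simp add: oriented_at_def\<close>)
  moreover have "(norm (U (y + e1) - U y) - rest_length lam y)\<^sup>2 + (norm (U (y + e2) - U y) - rest_length lam y)\<^sup>2 \<le> star_energy lam U y"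
    using star_energy_ge2[of e1 e2 U y lam] by (simp add: hexdirs_def norm_minus_commute)
  moreover have "(norm (U (y + e2) - U (y + e1)) - rest_length lam y)\<^sup>2 \<le> star_energy lam U (y + e2)"
    using star_energy_ge[of e3 U "y + e2" lam] by (simp add: hexdirs_def y rest_length_def)
  moreover have "(norm (down_defect U y))\<^sup>2 \<le> 6 * ((norm (U (y + e2) - U (y + (1, 1))) - rest_length lam (y + e1))\<^sup>2 + (norm (U (y + e1) - U (y + (1, 1))) - rest_length lam (y + e1))\<^sup>2
      + (norm (U (y + e1) - U (y + e2)) - rest_length lam (y + e1))\<^sup>2)"
    unfolding down_defect_def by (rule equilateral_defect) (use assms in \<open>simp add: oriented_at_def\<close>)
  moreover have "(norm (U (y + e1) - U (y + (1, 1))) - rest_length lam (y + e1))\<^sup>2 + (norm (U (y + e1) - U (y + e2)) - rest_length lam (y + e1))\<^sup>2 \<le> star_energy lam U (y + e1)"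
    using star_energy_ge2[of e2 "-e3" U "y + e1" lam] by (simp add: hexdirs_def y)
  moreover have "(norm (U (y + e2) - U (y + (1, 1))) - rest_length lam (y + e1))\<^sup>2 \<le> star_energy lam U (y + (1, 1))"
    using star_energy_ge[of "-e1" U "y + (1, 1)" lam] by (simp add: hexdirs_def y rest_length_def norm_minus_commute)
  ultimately show ?thesis by argo
qed

lemma sum_shift_le:
  fixes w :: "int \<times> int \<Rightarrow> real"
  assumes "finite B" "\<And>x. 0 \<le> w x" "\<And>x. x \<in> A \<Longrightarrow> x + e \<in> B"
  shows "(\<Sum>x\<in>A. w (x + e)) \<le> (\<Sum>x\<in>B. w x)"
proof -
  have "(\<Sum>x\<in>A. w (x + e)) = (\<Sum>x\<in>(\<lambda>x. x + e) ` A. w x)"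
    by (subst sum.reindex) (auto simp: inj_on_def)
  also have "\<dots> \<le> (\<Sum>x\<in>B. w x)" by (rule sum_mono2) (use assms in auto)
  finally show ?thesis .
qed

text \<open>The Laplacian of the step profile is concentrated on the columns \<open>-1\<close> and \<open>0\<close>, with opposite signs. The
test function has its centre in the column \<open>-m\<close> and is three quarters through its support at the
interface.\<close>
lemma step_profile_flux:
  assumes "1 \<le> m" "0 < lam" "lam < 1"
  defines "A \<equiv> {-3 * m..m} \<times> {0..4 * m}"
  shows "(\<Sum>x\<in>A. (bump m (fst x + 3 * m) * bump m (snd x)) * laplace (\<lambda>x. (rest_length lam x)\<^sup>2) x)
     \<le> - 216 * (1 - lam\<^sup>2) * of_int m ^ 8"
proof -
  define k where "k = 1 - lam\<^sup>2"
  have k: "0 < k" using assms by (simp add: k_def power_strict_decreasing abs_square_less_1)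
  define L :: "int \<Rightarrow> real" where "L s = (if s = -1 then - 2 * k else if s = 0 then 2 * k else 0)" for s
  have L: "laplace (\<lambda>x. (rest_length lam x)\<^sup>2) x = L (fst x)" for x
    by (cases x) (auto simp: laplace_def rest_length_def L_def k_def)
  have "(\<Sum>x\<in>A. (bump m (fst x + 3 * m) * bump m (snd x)) * laplace (\<lambda>x. (rest_length lam x)\<^sup>2) x)
     = (\<Sum>s\<in>{-3 * m..m}. \<Sum>t\<in>{0..4 * m}. (bump m (s + 3 * m) * L s) * bump m t)"
    unfolding A_def L sum.cartesian_product by (rule sum.cong[OF refl]) auto
  also have "\<dots> = (\<Sum>s\<in>{-3 * m..m}. bump m (s + 3 * m) * L s) * (\<Sum>t\<in>{0..4 * m}. bump m t)"
    by (simp add: sum_product)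
  also have "(\<Sum>s\<in>{-3 * m..m}. bump m (s + 3 * m) * L s) = (\<Sum>s\<in>{-1, 0}. bump m (s + 3 * m) * L s)"
    by (rule sum.mono_neutral_right) (use assms(1) in \<open>auto simp: L_def\<close>)
  also have "\<dots> = 2 * k * (bump m (3 * m) - bump m (3 * m - 1))"
    by (simp add: L_def algebra_simps)
  also have "2 * k * (bump m (3 * m) - bump m (3 * m - 1)) * (\<Sum>t\<in>{0..4 * m}. bump m t)
      \<le> 2 * k * (- 6 * of_int m ^ 3) * (\<Sum>t\<in>{0..4 * m}. bump m t)"
    by (intro mult_right_mono mult_left_mono bump_descent sum_nonneg bump_nonneg) (use k assms in auto)
  also have "\<dots> \<le> 2 * k * (- 6 * of_int m ^ 3) * (18 * of_int m ^ 5)"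
    by (rule mult_left_mono_neg[OF bump_sum[OF assms(1)]]) (use k assms in auto)
  also have "\<dots> = - 216 * (1 - lam\<^sup>2) * of_int m ^ 8"
    by (simp add: k_def algebra_simps flip: power_add)
  finally show ?thesis .
qed

text \<open>The linear terms are absorbed by Young's inequality with parameter \<open>\<theta>\<close>.\<close>
lemma near_rest_length:
  fixes a b :: complex
  assumes "0 < mu" "mu \<le> 1" "0 < \<theta>"
  shows "\<bar>(norm (a - b))\<^sup>2 - mu\<^sup>2\<bar> \<le> (2 + 1 / \<theta>) * ((norm a - mu)\<^sup>2 + (norm b)\<^sup>2) + 2 * \<theta>"
proof -
  define r g where "r = norm a - mu" and "g = norm b"
  have young: "2 * \<bar>x\<bar> \<le> \<theta> + x\<^sup>2 / \<theta>" for x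
  proof -
    have "0 \<le> (\<theta> - \<bar>x\<bar>)\<^sup>2 / \<theta>" using assms by simp
    also have "\<dots> = \<theta> + x\<^sup>2 / \<theta> - 2 * \<bar>x\<bar>" using assms by (simp add: power2_eq_square field_simps)
    finally show ?thesis by simp
  qed
  have "(norm (a - b))\<^sup>2 = (norm a)\<^sup>2 - 2 * (a \<bullet> b) + g\<^sup>2"
    by (simp add: g_def power2_norm_eq_inner inner_diff_left inner_diff_right inner_commute)
  moreover have "(norm a)\<^sup>2 = mu\<^sup>2 + r\<^sup>2 + 2 * (mu * r)"
    by (simp add: r_def power2_eq_square algebra_simps)
  moreover have "\<bar>a \<bullet> b\<bar> \<le> norm a * g" unfolding g_def by (rule Cauchy_Schwarz_ineq2)
  moreover have "norm a * g \<le> (1 + \<bar>r\<bar>) * g"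
    by (rule mult_right_mono) (use assms in \<open>auto simp: r_def g_def\<close>)
  moreover have "2 * (\<bar>r\<bar> * g) \<le> r\<^sup>2 + g\<^sup>2"
    using zero_le_power2[of "\<bar>r\<bar> - g"] by (simp add: power2_eq_square algebra_simps)
  moreover have "\<bar>mu * r\<bar> \<le> \<bar>r\<bar>"
    using mult_right_mono[OF assms(2), of "\<bar>r\<bar>"] assms by (simp add: abs_mult)
  moreover have "2 * \<bar>r\<bar> \<le> \<theta> + r\<^sup>2 / \<theta>" "2 * g \<le> \<theta> + g\<^sup>2 / \<theta>"
    using young[of r] young[of g] by (auto simp: g_def)
  moreover have "(1 + \<bar>r\<bar>) * g = g + \<bar>r\<bar> * g" by (simp add: algebra_simps)
  ultimately have "\<bar>(norm (a - b))\<^sup>2 - mu\<^sup>2\<bar> \<le> 2 * r\<^sup>2 + 2 * g\<^sup>2 + 2 * \<theta> + r\<^sup>2 / \<theta> + g\<^sup>2 / \<theta>"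
    using zero_le_power2[of r] zero_le_power2[of g] unfolding abs_le_iff by linarith
  also have "\<dots> = (2 + 1 / \<theta>) * (r\<^sup>2 + g\<^sup>2) + 2 * \<theta>" using assms by (simp add: field_simps)
  finally show ?thesis by (simp add: r_def g_def)
qed

lemma laplace_eq_0_outside:
  assumes "\<And>e. e \<in> insert 0 hexdirs \<Longrightarrow> p (x + e) = 0"
  shows "laplace p x = 0"
  using assms[of 0] assms[of e1] assms[of "-e1"] assms[of e2] assms[of "-e2"] assms[of e3] assms[of "-e3"]
  by (cases x) (simp add: laplace_def hexdirs_def)

text \<open>The quadratic lower bound for a lattice deformation \<open>U\<close> in a box around the interface.\<close>
lemma discrete_transition_bound:
  fixes U :: "int \<times> int \<Rightarrow> complex" and m :: int
  assumes m: "1 \<le> m" and lam: "0 < lam" "lam < 1"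
  assumes ori: "\<And>y. y \<in> {-3 * m - 1..m + 1} \<times> {-1..4 * m + 1} \<Longrightarrow> oriented_at U y"
  shows "(1 - lam\<^sup>2)\<^sup>2 / 2000000 * (of_int m)\<^sup>2 \<le> (\<Sum>x\<in>{-3 * m - 1..m + 2} \<times> {-1..4 * m + 2}. star_energy lam U x)"
proof -
  define A where "A = {-3 * m..m} \<times> {0..4 * m}"
  define B where "B = {-3 * m - 1..m + 2} \<times> {-1..4 * m + 2}"
  define \<eta> where "\<eta> = (\<Sum>x\<in>B. star_energy lam U x)"
  define M where "M = real_of_int m"
  define k where "k = 1 - lam\<^sup>2"
  define mu where "mu = rest_length lam"
  have M: "1 \<le> M" using m by (simp add: M_def)
  have k: "0 < k" "k \<le> 1" using lam by (simp_all add: k_def power_strict_decreasing abs_square_less_1)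
  have mu: "0 < mu x" "mu x \<le> 1" for x using lam by (simp_all add: mu_def rest_length_def)
  have finA: "finite A" by (simp add: A_def)
  have finB: "finite B" by (simp add: B_def)
  have AsubT: "A \<subseteq> thick A"
  proof
    fix x assume "x \<in> A" thus "x \<in> thick A" by (rule in_thick[where d = 0]) auto
  qed
  have T: "thick A \<subseteq> {-3 * m - 1..m + 1} \<times> {-1..4 * m + 1}"
    using thick_box[of "-3 * m" m 0 "4 * m"] by (simp add: A_def)
  have AB: "A \<subseteq> B" by (auto simp: A_def B_def)
  \<comment> \<open>\<open>U - g\<close> is the harmonic replacement of \<open>U\<close> in the box \<open>A\<close>, and \<open>d\<close> below is its difference in direction \<open>e2\<close>.\<close>
  obtain g where g0: "\<And>x. x \<notin> A \<Longrightarrow> g x = 0" and lg: "\<And>x. x \<in> A \<Longrightarrow> laplace g x = laplace U x"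
    using poisson_solvable[OF finA, of "laplace U"] by blast
  have "(\<Sum>x\<in>thick A. (norm (g (x + e2) - g x))\<^sup>2) \<le> (\<Sum>x\<in>thick A. (norm (up_defect U x))\<^sup>2 + (norm (down_defect U x))\<^sup>2)"
    using replacement_estimate[OF finA, of g U] g0 lg by blast
  also have "\<dots> \<le> (\<Sum>x\<in>thick A. 6 * (star_energy lam U x + star_energy lam U (x + e2) + star_energy lam U (x + e1) + star_energy lam U (x + (1, 1))))"
    by (rule sum_mono, rule triangles_le_star) (use ori T in blast)
  also have "\<dots> = 6 * ((\<Sum>x\<in>thick A. star_energy lam U (x + 0)) + (\<Sum>x\<in>thick A. star_energy lam U (x + e2))
      + (\<Sum>x\<in>thick A. star_energy lam U (x + e1)) + (\<Sum>x\<in>thick A. star_energy lam U (x + (1, 1))))"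
    by (simp add: sum.distrib sum_distrib_left)
  also have "\<dots> \<le> 6 * (\<eta> + \<eta> + \<eta> + \<eta>)"
    unfolding \<eta>_def by (intro mult_left_mono add_mono sum_shift_le finB star_energy_nonneg) (use T in \<open>force simp: B_def\<close>)+
  finally have "(\<Sum>x\<in>thick A. (norm (g (x + e2) - g x))\<^sup>2) \<le> 24 * \<eta>" by simp
  moreover have "(\<Sum>x\<in>A. (norm (g (x + e2) - g x))\<^sup>2) \<le> (\<Sum>x\<in>thick A. (norm (g (x + e2) - g x))\<^sup>2)"
    by (rule sum_mono2) (use AsubT finA in \<open>auto simp: finite_thick\<close>)
  ultimately have dg: "(\<Sum>x\<in>A. (norm (g (x + e2) - g x))\<^sup>2) \<le> 24 * \<eta>" by linarith
  have dU: "(\<Sum>x\<in>A. (norm (U (x + e2) - U x) - mu x)\<^sup>2) \<le> \<eta>"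
  proof -
    have "(\<Sum>x\<in>A. (norm (U (x + e2) - U x) - mu x)\<^sup>2) \<le> (\<Sum>x\<in>A. star_energy lam U x)"
    proof (rule sum_mono)
      fix x
      show "(norm (U (x + e2) - U x) - mu x)\<^sup>2 \<le> star_energy lam U x"
        using star_energy_ge[of e2 U x lam] by (simp add: hexdirs_def mu_def norm_minus_commute)
    qed
    also have "\<dots> \<le> \<eta>" unfolding \<eta>_def by (rule sum_mono2) (use AB finB star_energy_nonneg in auto)
    finally show ?thesis .
  qed
  define d where "d x = (U (x + e2) - U x) - (g (x + e2) - g x)" for x
  define f where "f x = (norm (d x))\<^sup>2" for x
  define p where "p x = bump m (fst x + 3 * m) * bump m (snd x)" for x
  have p_nonneg: "0 \<le> p x" for x by (simp add: p_def bump_nonneg)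
  have p_supp: "-3 * m < fst x \<and> fst x < m \<and> 0 < snd x \<and> snd x < 4 * m" if "p x \<noteq> 0" for x
    using that bump_zero[of "fst x + 3 * m" m] bump_zero[of "snd x" m] by (fastforce simp: p_def)
  have pA: "p x = 0" if "x \<notin> A" for x
  proof (rule ccontr)
    assume "p x \<noteq> 0"
    from p_supp[OF this] that show False by (auto simp: A_def mem_Times_iff)
  qed
  have lpA: "laplace p x = 0" if "x \<notin> A" for x
  proof (rule laplace_eq_0_outside)
    fix e assume e: "e \<in> insert 0 hexdirs"
    show "p (x + e) = 0"
    proof (rule ccontr)
      assume "p (x + e) \<noteq> 0"
      from p_supp[OF this] e that show False by (cases x) (auto simp: A_def hexdirs_def)
    qed
  qed
  have laplace_d: "laplace d x = 0" if "p x \<noteq> 0" for x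
  proof -
    have "x \<in> A" "x + e2 \<in> A" using p_supp[OF that] by (cases x; auto simp: A_def)+
    moreover have "laplace d x = (laplace U (x + e2) - laplace U x) - (laplace g (x + e2) - laplace g x)"
      by (cases x) (simp add: laplace_def d_def algebra_simps)
    ultimately show ?thesis using lg by simp
  qed
  have "0 \<le> (\<Sum>x\<in>thick A. p x * laplace f x)"
  proof (rule sum_nonneg)
    fix x show "0 \<le> p x * laplace f x"
    proof (cases "p x = 0")
      case False
      have "0 \<le> laplace f x" unfolding f_def by (rule laplace_norm_sq[OF laplace_d[OF False]])
      thus ?thesis using p_nonneg by simp
    qed simp
  qed
  also have "\<dots> = (\<Sum>x\<in>thick A. laplace p x * f x)" by (rule sum_mult_lap[OF finA pA])
  also have "\<dots> = (\<Sum>x\<in>thick A. laplace p x * (mu x)\<^sup>2) + (\<Sum>x\<in>thick A. laplace p x * (f x - (mu x)\<^sup>2))"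
    by (simp add: algebra_simps flip: sum.distrib)
  also have "(\<Sum>x\<in>thick A. laplace p x * (mu x)\<^sup>2) = (\<Sum>x\<in>thick A. p x * laplace (\<lambda>x. (mu x)\<^sup>2) x)"
    by (rule sum_mult_lap[OF finA pA, symmetric])
  also have "\<dots> = (\<Sum>x\<in>A. p x * laplace (\<lambda>x. (mu x)\<^sup>2) x)"
    by (rule sum.mono_neutral_right) (use AsubT finA pA in \<open>auto simp: finite_thick\<close>)
  also have "\<dots> \<le> - 216 * k * M ^ 8"
    using step_profile_flux[OF m lam] unfolding A_def p_def mu_def k_def M_def .
  also have "(\<Sum>x\<in>thick A. laplace p x * (f x - (mu x)\<^sup>2)) = (\<Sum>x\<in>A. laplace p x * (f x - (mu x)\<^sup>2))"
    by (rule sum.mono_neutral_right) (use AsubT finA lpA in \<open>auto simp: finite_thick\<close>)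
  finally have main: "216 * k * M ^ 8 \<le> (\<Sum>x\<in>A. laplace p x * (f x - (mu x)\<^sup>2))" by linarith
  \<comment> \<open>With this \<open>\<theta>\<close> the terms without energy add up to less than half of \<open>216 * k * M ^ 8\<close>.\<close>
  define \<theta> where "\<theta> = k / 2000"
  have th: "0 < \<theta>" using k by (simp add: \<theta>_def)
  have lp: "\<bar>laplace p x\<bar> \<le> 4096 * M ^ 6" for x
  proof -
    have "\<bar>laplace p x\<bar> \<le> 4 * (16 * M ^ 4) * (32 * M ^ 2) + 2 * (32 * M ^ 3)\<^sup>2"
      unfolding p_def M_def
    proof (rule laplace_product_bound)
      fix t
      show "\<bar>bump m (t + 1 + 3 * m) - bump m (t + 3 * m)\<bar> \<le> 32 * of_int m ^ 3"
        using bump_step[OF m, of "t + 3 * m"] by (simp add: algebra_simps)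
      show "\<bar>bump m (t + 1 + 3 * m) + bump m (t - 1 + 3 * m) - 2 * bump m (t + 3 * m)\<bar> \<le> 32 * of_int m ^ 2"
        using bump_second[OF m, of "t + 3 * m"] by (simp add: algebra_simps)
    qed (use m in \<open>auto intro: bump_nonneg bump_le bump_step bump_second\<close>)
    also have "\<dots> = 4096 * M ^ 6" by (simp add: power_mult_distrib flip: power_add power_mult)
    finally show ?thesis .
  qed
  have "(\<Sum>x\<in>A. laplace p x * (f x - (mu x)\<^sup>2)) \<le>
     (\<Sum>x\<in>A. 4096 * M ^ 6 * ((2 + 1 / \<theta>) * ((norm (U (x + e2) - U x) - mu x)\<^sup>2 + (norm (g (x + e2) - g x))\<^sup>2) + 2 * \<theta>))"
  proof (rule sum_mono)
    fix x
    have "laplace p x * (f x - (mu x)\<^sup>2) \<le> \<bar>laplace p x\<bar> * \<bar>f x - (mu x)\<^sup>2\<bar>"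
      by (metis abs_ge_self abs_mult)
    also have "\<dots> \<le> 4096 * M ^ 6 * ((2 + 1 / \<theta>) * ((norm (U (x + e2) - U x) - mu x)\<^sup>2 + (norm (g (x + e2) - g x))\<^sup>2) + 2 * \<theta>)"
      by (rule mult_mono[OF lp]) (use near_rest_length[OF mu th] M in \<open>auto simp: f_def d_def\<close>)
    finally show "laplace p x * (f x - (mu x)\<^sup>2) \<le> \<dots>" .
  qed
  also have "\<dots> = 4096 * M ^ 6 * ((2 + 1 / \<theta>) * ((\<Sum>x\<in>A. (norm (U (x + e2) - U x) - mu x)\<^sup>2)
      + (\<Sum>x\<in>A. (norm (g (x + e2) - g x))\<^sup>2)) + 2 * \<theta> * real (card A))"
    unfolding sum_distrib_left[symmetric] sum.distrib by simp
  also have "\<dots> \<le> 4096 * M ^ 6 * ((2 + 1 / \<theta>) * (\<eta> + 24 * \<eta>) + 2 * \<theta> * (25 * M\<^sup>2))"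
  proof -
    have "card A = nat (4 * m + 1) * nat (4 * m + 1)" using m by (simp add: A_def card_cartesian_product)
    hence "real (card A) = (4 * M + 1)\<^sup>2" using m by (simp add: M_def power2_eq_square)
    also have "\<dots> \<le> (5 * M)\<^sup>2" by (rule power_mono) (use M in auto)
    finally have "real (card A) \<le> 25 * M\<^sup>2" by (simp add: power_mult_distrib)
    thus ?thesis
      by (intro mult_left_mono add_mono dU dg) (use th M in auto)
  qed
  finally have "216 * k * M ^ 8 \<le> 4096 * M ^ 6 * ((2 + 1 / \<theta>) * (\<eta> + 24 * \<eta>) + 2 * \<theta> * (25 * M\<^sup>2))"
    using main by linarith
  hence "M ^ 6 * (216 * k * M\<^sup>2) \<le> M ^ 6 * (4096 * ((2 + 1 / \<theta>) * (\<eta> + 24 * \<eta>) + 2 * \<theta> * (25 * M\<^sup>2)))"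
    by (simp add: algebra_simps flip: power_add)
  hence E1: "216 * k * M\<^sup>2 \<le> 4096 * ((2 + 1 / \<theta>) * (\<eta> + 24 * \<eta>) + 2 * \<theta> * (25 * M\<^sup>2))"
    using M by (simp add: mult_le_cancel_left)
  have E2: "2 * \<theta> * (25 * M\<^sup>2) = k * M\<^sup>2 / 40" by (simp add: \<theta>_def)
  have E3: "(2 + 1 / \<theta>) * (\<eta> + 24 * \<eta>) \<le> 50050 / k * \<eta>"
  proof -
    have "\<eta> \<ge> 0" unfolding \<eta>_def by (rule sum_nonneg) (rule star_energy_nonneg)
    moreover have "(2 + 1 / \<theta>) * 25 \<le> 50050 / k" using k by (simp add: \<theta>_def field_simps)
    ultimately have "(2 + 1 / \<theta>) * 25 * \<eta> \<le> 50050 / k * \<eta>" by (intro mult_right_mono)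
    thus ?thesis by (simp add: algebra_simps)
  qed
  have "216 * k * M\<^sup>2 \<le> 4096 * (50050 / k * \<eta> + k * M\<^sup>2 / 40)"
    by (rule order_trans[OF E1]) (intro mult_left_mono add_mono E3 eq_refl[OF E2], simp)
  hence "k * (216 * k * M\<^sup>2) \<le> k * (4096 * (50050 / k * \<eta> + k * M\<^sup>2 / 40))"
    using k by (intro mult_left_mono) auto
  also have "\<dots> = 205004800 * \<eta> + 4096 / 40 * (k\<^sup>2 * M\<^sup>2)"
    using k by (simp add: field_simps power2_eq_square)
  also have "k * (216 * k * M\<^sup>2) = 216 * (k\<^sup>2 * M\<^sup>2)" by (simp add: power2_eq_square)
  finally have "k\<^sup>2 * M\<^sup>2 \<le> 2000000 * \<eta>"
    using sum_nonneg[of B "star_energy lam U", OF star_energy_nonneg] unfolding \<eta>_def by argo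
  thus ?thesis unfolding k_def M_def \<eta>_def B_def by simp
qed

section \<open>The Delaunay triangulation of the hexagonal lattice\<close>

text \<open>The lattice point with given integer coordinates.\<close>
definition lattice_pt :: "int \<times> int \<Rightarrow> real^2" where
  "lattice_pt p = of_int (fst p) *\<^sub>R w1 + of_int (snd p) *\<^sub>R w2"

text \<open>The coordinates of a vector with respect to the basis \<open>w1\<close>, \<open>w2\<close>.\<close>
definition coord1 :: "real^2 \<Rightarrow> real" where "coord1 x = x $ 1 - x $ 2 / sqrt 3"
definition coord2 :: "real^2 \<Rightarrow> real" where "coord2 x = 2 * x $ 2 / sqrt 3"

lemma linear_sc: "linear coord1" and linear_tc: "linear coord2"
  by (auto intro!: linearI simp: coord1_def coord2_def algebra_simps add_divide_distrib)

lemma coords_simps [simp]: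
  "coord1 (x + y) = coord1 x + coord1 y" "coord1 (x - y) = coord1 x - coord1 y" "coord1 (c *\<^sub>R x) = c * coord1 x" "coord1 0 = 0"
  "coord2 (x + y) = coord2 x + coord2 y" "coord2 (x - y) = coord2 x - coord2 y" "coord2 (c *\<^sub>R x) = c * coord2 x" "coord2 0 = 0"
  using linear_sc linear_tc by (simp_all add: linear_add linear_diff linear_scale linear_0)

lemma coords_w [simp]: "coord1 w1 = 1" "coord1 w2 = 0" "coord2 w1 = 0" "coord2 w2 = 1"
  by (simp_all add: coord1_def coord2_def w1_def w2_def)

lemma coords_pt [simp]: "coord1 (lattice_pt p) = of_int (fst p)" "coord2 (lattice_pt p) = of_int (snd p)"
  by (simp_all add: lattice_pt_def)

lemma comp_coords: "x $ 1 = coord1 x + coord2 x / 2" "x $ 2 = sqrt 3 / 2 * coord2 x"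
  by (simp_all add: coord1_def coord2_def)

lemma coords_eqI: "coord1 x = coord1 y \<Longrightarrow> coord2 x = coord2 y \<Longrightarrow> x = y"
  by (simp add: vec_eq_iff forall_2 comp_coords)

lemma coords_expand: "x = coord1 x *\<^sub>R w1 + coord2 x *\<^sub>R w2"
  by (rule coords_eqI) auto

lemma norm_coords: "(norm x)\<^sup>2 = (coord1 x)\<^sup>2 + coord1 x * coord2 x + (coord2 x)\<^sup>2"
proof -
  have "(norm x)\<^sup>2 = (x $ 1)\<^sup>2 + (x $ 2)\<^sup>2"
    unfolding power2_norm_eq_inner by (simp add: inner_vec_def sum_2 power2_eq_square)
  thus ?thesis by (simp add: comp_coords power_mult_distrib power_divide) (simp add: power2_eq_square algebra_simps)
qed

lemma inj_pt: "inj lattice_pt"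
proof (rule injI)
  fix p q assume "lattice_pt p = lattice_pt q"
  hence "coord1 (lattice_pt p) = coord1 (lattice_pt q)" "coord2 (lattice_pt p) = coord2 (lattice_pt q)" by simp_all
  thus "p = q" by (simp add: prod_eq_iff)
qed

lemma lattice_pt_eq_iff [simp]: "lattice_pt p = lattice_pt q \<longleftrightarrow> p = q"
  using inj_pt by (auto dest: injD)

lemma lattice_pt_add: "lattice_pt (p + q) = lattice_pt p + lattice_pt q" by (rule coords_eqI) auto
lemma lattice_pt_diff: "lattice_pt (p - q) = lattice_pt p - lattice_pt q" by (rule coords_eqI) auto

lemma lattice_minus_eq: "lattice_minus = lattice_pt ` {p. fst p < 0}"
  unfolding lattice_minus_def lattice_pt_def by (auto simp: image_iff; blast)

lemma lattice_plus_eq: "lattice_plus 1 = lattice_pt ` {p. 0 \<le> fst p}"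
  unfolding lattice_plus_def lattice_pt_def by (auto simp: image_iff; blast)

lemma lattice_eq: "lattice 1 = range lattice_pt"
  by (force simp: lattice_def lattice_minus_eq lattice_plus_eq)

text \<open>The unit triangles are obtained from a corner \<open>p\<close> by adding \<open>\<sigma> w1\<close> and \<open>\<sigma> w2\<close>, with \<open>\<sigma> = 1\<close> for the
triangles pointing upwards (\<open>p\<close> is the lower left corner) and \<open>\<sigma> = -1\<close> for those pointing downwards (\<open>p\<close> is
the upper right corner). In both cases the three vertices are in anticlockwise order.\<close>
definition unit_triangle :: "int \<Rightarrow> int \<times> int \<Rightarrow> (real^2) set" where
  "unit_triangle \<sigma> p = {lattice_pt p, lattice_pt (p + (\<sigma>, 0)), lattice_pt (p + (0, \<sigma>))}"

text \<open>All closed unit triangles, encoded by their vertices.\<close>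
definition unit_triangles :: "(real^2) set set" where
  "unit_triangles = {unit_triangle \<sigma> p | \<sigma> p. \<sigma> \<in> {1, -1}}"

lemma open_triangle_unit_triangle:
  assumes "\<sigma> \<in> {1, -1}"
  shows "open_triangle (unit_triangle \<sigma> p) = {x. 0 < of_int \<sigma> * (coord1 x - of_int (fst p)) \<and> 0 < of_int \<sigma> * (coord2 x - of_int (snd p))
     \<and> of_int \<sigma> * (coord1 x - of_int (fst p)) + of_int \<sigma> * (coord2 x - of_int (snd p)) < 1}" (is "_ = ?R")
proof -
  let ?a = "lattice_pt p" and ?b = "lattice_pt (p + (\<sigma>, 0))" and ?c = "lattice_pt (p + (0, \<sigma>))"
  have nc: "\<not> collinear {?a, ?b, ?c}"
  proof
    assume "collinear {?a, ?b, ?c}"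
    then obtain u where u: "?b = u *\<^sub>R ?a + (1 - u) *\<^sub>R ?c"
      using assms by (auto simp: collinear_3_expand prod_eq_iff)
    have "coord1 ?b = coord1 (u *\<^sub>R ?a + (1 - u) *\<^sub>R ?c)" "coord2 ?b = coord2 (u *\<^sub>R ?a + (1 - u) *\<^sub>R ?c)"
      using u by simp_all
    thus False using assms by (auto simp: algebra_simps)
  qed
  have "open_triangle (unit_triangle \<sigma> p) = {v. \<exists>x y z. 0 < x \<and> 0 < y \<and> 0 < z \<and> x + y + z = 1 \<and> x *\<^sub>R ?a + y *\<^sub>R ?b + z *\<^sub>R ?c = v}"
    unfolding open_triangle_def unit_triangle_def by (rule interior_convex_hull_3_minimal[OF nc]) simp
  also have "\<dots> = ?R"
  proof (rule antisym; rule subsetI)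
    fix v assume "v \<in> {v. \<exists>x y z. 0 < x \<and> 0 < y \<and> 0 < z \<and> x + y + z = 1 \<and> x *\<^sub>R ?a + y *\<^sub>R ?b + z *\<^sub>R ?c = v}"
    then obtain x y z where xyz: "0 < x" "0 < y" "0 < z" and s: "x + y + z = 1"
      and v: "v = x *\<^sub>R ?a + y *\<^sub>R ?b + z *\<^sub>R ?c" by blast
    have x: "x = 1 - y - z" using s by simp
    have "coord1 v - of_int (fst p) = y * of_int \<sigma>" "coord2 v - of_int (snd p) = z * of_int \<sigma>"
      unfolding v x by (simp_all add: algebra_simps)
    thus "v \<in> ?R" using assms xyz s by auto
  next
    fix v assume "v \<in> ?R"
    define y z where "y = of_int \<sigma> * (coord1 v - of_int (fst p))" and "z = of_int \<sigma> * (coord2 v - of_int (snd p))"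
    have "(1 - y - z) *\<^sub>R ?a + y *\<^sub>R ?b + z *\<^sub>R ?c = v"
      by (rule coords_eqI) (use assms in \<open>auto simp: y_def z_def algebra_simps\<close>)
    moreover have "0 < y" "0 < z" "0 < 1 - y - z" "1 - y - z + y + z = 1"
      using \<open>v \<in> ?R\<close> by (auto simp: y_def z_def)
    ultimately show "v \<in> {v. \<exists>x y z. 0 < x \<and> 0 < y \<and> 0 < z \<and> x + y + z = 1 \<and> x *\<^sub>R ?a + y *\<^sub>R ?b + z *\<^sub>R ?c = v}"
      by blast
  qed
  finally show ?thesis .
qed

lemma open_triangle_unit_triangle_nonempty: "\<sigma> \<in> {1, -1} \<Longrightarrow> open_triangle (unit_triangle \<sigma> p) \<noteq> {}"
proof -
  assume s: "\<sigma> \<in> {1, -1}"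
  have "lattice_pt p + (of_int \<sigma> / 3) *\<^sub>R w1 + (of_int \<sigma> / 3) *\<^sub>R w2 \<in> open_triangle (unit_triangle \<sigma> p)"
    unfolding open_triangle_unit_triangle[OF s] using s by auto
  thus ?thesis by blast
qed

lemma closure_open_triangle_unit_triangle:
  "\<sigma> \<in> {1, -1} \<Longrightarrow> closure (open_triangle (unit_triangle \<sigma> p)) = convex hull (unit_triangle \<sigma> p)"
  using open_triangle_unit_triangle_nonempty[of \<sigma> p] unfolding open_triangle_def
  by (subst convex_closure_interior) (auto simp: unit_triangle_def finite_imp_compact compact_convex_hull compact_imp_closed)

text \<open>The integer parts of \<open>coord1 x\<close>, \<open>coord2 x\<close> and \<open>coord1 x + coord2 x\<close> determine the open unit triangle
that contains \<open>x\<close>.\<close>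
lemma unit_triangle_disjoint:
  assumes "\<sigma> \<in> {1, -1}" "\<tau> \<in> {1, -1}" and x: "x \<in> open_triangle (unit_triangle \<sigma> p)" "x \<in> open_triangle (unit_triangle \<tau> q)"
  shows "\<sigma> = \<tau> \<and> p = q"
proof -
  have *: "fst r = \<lfloor>coord1 x\<rfloor> + (if \<rho> = 1 then 0 else 1) \<and> snd r = \<lfloor>coord2 x\<rfloor> + (if \<rho> = 1 then 0 else 1)
     \<and> \<lfloor>coord1 x + coord2 x\<rfloor> = \<lfloor>coord1 x\<rfloor> + \<lfloor>coord2 x\<rfloor> + (if \<rho> = 1 then 0 else 1)"
    if "\<rho> \<in> {1, -1}" "x \<in> open_triangle (unit_triangle \<rho> r)" for \<rho> r
  proof (cases "\<rho> = 1")
    case True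
    have "\<lfloor>coord1 x\<rfloor> = fst r" "\<lfloor>coord2 x\<rfloor> = snd r" "\<lfloor>coord1 x + coord2 x\<rfloor> = fst r + snd r"
      using that(2) True unfolding open_triangle_unit_triangle[OF that(1)] by (auto simp: floor_eq_iff)
    thus ?thesis using True by simp
  next
    case False
    hence "\<rho> = -1" using that by simp
    hence "\<lfloor>coord1 x\<rfloor> = fst r - 1" "\<lfloor>coord2 x\<rfloor> = snd r - 1" "\<lfloor>coord1 x + coord2 x\<rfloor> = fst r + snd r - 1"
      using that(2) unfolding open_triangle_unit_triangle[OF that(1)] by (auto simp: floor_eq_iff)
    thus ?thesis using False by simp
  qed
  show ?thesis using *[OF assms(1) x(1)] *[OF assms(2) x(2)] assms(1,2) by (auto simp: prod_eq_iff)
qed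

lemma unit_triangle_cover: "\<exists>\<sigma>\<in>{1, -1}. \<exists>p. x \<in> convex hull (unit_triangle \<sigma> p)"
proof -
  define i j where "i = frac (coord1 x)" and "j = frac (coord2 x)"
  define p where "p = (\<lfloor>coord1 x\<rfloor>, \<lfloor>coord2 x\<rfloor>)"
  have ij: "0 \<le> i" "i < 1" "0 \<le> j" "j < 1" by (simp_all add: i_def j_def frac_lt_1)
  show ?thesis
  proof (cases "i + j \<le> 1")
    case True
    have "x = (1 - i - j) *\<^sub>R lattice_pt p + i *\<^sub>R lattice_pt (p + (1, 0)) + j *\<^sub>R lattice_pt (p + (0, 1))"
      by (rule coords_eqI) (auto simp: p_def i_def j_def frac_def algebra_simps)
    hence "x \<in> convex hull (unit_triangle 1 p)"
      unfolding unit_triangle_def convex_hull_3 using ij True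
      by (intro CollectI exI[of _ "1 - i - j"] exI[of _ i] exI[of _ j]) auto
    thus ?thesis by blast
  next
    case False
    have "x = (i + j - 1) *\<^sub>R lattice_pt (p + (1, 1)) + (1 - i) *\<^sub>R lattice_pt (p + (1, 1) + (-1, 0)) + (1 - j) *\<^sub>R lattice_pt (p + (1, 1) + (0, -1))"
      by (rule coords_eqI) (auto simp: p_def i_def j_def frac_def algebra_simps)
    hence "x \<in> convex hull (unit_triangle (-1) (p + (1, 1)))"
      unfolding unit_triangle_def convex_hull_3 using ij False
      by (intro CollectI exI[of _ "i + j - 1"] exI[of _ "1 - i"] exI[of _ "1 - j"]) auto
    thus ?thesis by blast
  qed
qed

lemma triangulation_unit: "triangulation (lattice 1) unit_triangles"
  unfolding triangulation_def
proof (intro conjI ballI impI)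
  fix V assume "V \<in> unit_triangles"
  then obtain \<sigma> p where V: "V = unit_triangle \<sigma> p" and s: "\<sigma> \<in> {1, -1}" by (auto simp: unit_triangles_def)
  show "V \<subseteq> lattice 1" by (auto simp: V unit_triangle_def lattice_eq)
  have "lattice_pt p \<noteq> lattice_pt (p + (\<sigma>, 0))" "lattice_pt p \<noteq> lattice_pt (p + (0, \<sigma>))" "lattice_pt (p + (\<sigma>, 0)) \<noteq> lattice_pt (p + (0, \<sigma>))"
    using s by (cases p; auto)+
  thus "card V = 3" unfolding V unit_triangle_def by simp
  show "open_triangle V \<noteq> {}" unfolding V by (rule open_triangle_unit_triangle_nonempty[OF s])
next
  fix V W assume "V \<in> unit_triangles" "W \<in> unit_triangles" "V \<noteq> W"
  thus "open_triangle V \<inter> open_triangle W = {}"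
    unfolding unit_triangles_def by (elim CollectE exE conjE) (metis (no_types) disjoint_iff unit_triangle_disjoint)
next
  show "(\<Union>V\<in>unit_triangles. closure (open_triangle V)) = UNIV"
  proof (intro set_eqI iffI UNIV_I)
    fix x
    obtain \<sigma> p where s: "\<sigma> \<in> {1, -1}" and x: "x \<in> convex hull (unit_triangle \<sigma> p)" using unit_triangle_cover by blast
    have "x \<in> closure (open_triangle (unit_triangle \<sigma> p))" using x closure_open_triangle_unit_triangle[OF s] by simp
    moreover have "unit_triangle \<sigma> p \<in> unit_triangles" using s unfolding unit_triangles_def by blast
    ultimately show "x \<in> (\<Union>V\<in>unit_triangles. closure (open_triangle V))" by (rule UN_I[rotated])
  qed
qed

lemma delaunay_unit: "delaunay (lattice 1) unit_triangles"
  unfolding delaunay_def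
proof (intro ballI allI impI)
  fix V c r assume "V \<in> unit_triangles" and Vs: "V \<subseteq> sphere c r"
  then obtain \<sigma> p where V: "V = unit_triangle \<sigma> p" and s: "\<sigma> \<in> {1, -1}" by (auto simp: unit_triangles_def)
  define a b where "a = coord1 c - of_int (fst p)" and "b = coord2 c - of_int (snd p)"
  have sq: "(dist c y)\<^sup>2 = r\<^sup>2" if "y \<in> V" for y using Vs that by auto
  have d: "(dist c (lattice_pt q))\<^sup>2 = (coord1 c - of_int (fst q))\<^sup>2 + (coord1 c - of_int (fst q)) * (coord2 c - of_int (snd q)) + (coord2 c - of_int (snd q))\<^sup>2" for q
    unfolding dist_norm norm_coords by simp
  have 0: "r\<^sup>2 = a\<^sup>2 + a * b + b\<^sup>2" using sq[of "lattice_pt p"] unfolding d by (simp add: V unit_triangle_def a_def b_def)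
  have 1: "r\<^sup>2 = (a - of_int \<sigma>)\<^sup>2 + (a - of_int \<sigma>) * b + b\<^sup>2"
    using sq[of "lattice_pt (p + (\<sigma>, 0))"] unfolding d by (simp add: V unit_triangle_def a_def b_def algebra_simps)
  have 2: "r\<^sup>2 = a\<^sup>2 + a * (b - of_int \<sigma>) + (b - of_int \<sigma>)\<^sup>2"
    using sq[of "lattice_pt (p + (0, \<sigma>))"] unfolding d by (simp add: V unit_triangle_def a_def b_def algebra_simps)
  have ab: "2 * a + b = of_int \<sigma>" "a + 2 * b = of_int \<sigma>"
  proof -
    have "of_int \<sigma> * (2 * a + b - of_int \<sigma>) = 0" using 0 1 by (simp add: power2_eq_square algebra_simps)
    moreover have "of_int \<sigma> * (a + 2 * b - of_int \<sigma>) = 0" using 0 2 by (simp add: power2_eq_square algebra_simps)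
    moreover have "of_int \<sigma> \<noteq> (0::real)" using s by auto
    ultimately show "2 * a + b = of_int \<sigma>" "a + 2 * b = of_int \<sigma>" by simp_all
  qed
  show "ball c r \<inter> lattice 1 = {}"
  proof (rule ccontr)
    assume "ball c r \<inter> lattice 1 \<noteq> {}"
    then obtain q where q: "dist c (lattice_pt q) < r" by (auto simp: lattice_eq)
    hence "(dist c (lattice_pt q))\<^sup>2 < r\<^sup>2" by (intro power_strict_mono) auto
    moreover define i j where "i = \<sigma> * (fst q - fst p)" and "j = \<sigma> * (snd q - snd p)"
    have qi: "real_of_int (fst q) = of_int (fst p) + of_int \<sigma> * of_int i" "real_of_int (snd q) = of_int (snd p) + of_int \<sigma> * of_int j"
      using s by (elim insertE emptyE; simp add: i_def j_def)+
    have "(dist c (lattice_pt q))\<^sup>2 - r\<^sup>2 = of_int ((i + j) * (i + j - 1) + i * (i - 1) + j * (j - 1)) / 2"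
    proof -
      define X Y S where "X = real_of_int i" and "Y = real_of_int j" and "S = real_of_int \<sigma>"
      have S: "S * S = 1" using s by (auto simp: S_def)
      have "(dist c (lattice_pt q))\<^sup>2 = (a - S * X)\<^sup>2 + (a - S * X) * (b - S * Y) + (b - S * Y)\<^sup>2"
        unfolding d qi a_def b_def X_def Y_def S_def by (simp add: algebra_simps)
      hence "(dist c (lattice_pt q))\<^sup>2 - r\<^sup>2 = (S * S) * (X\<^sup>2 + X * Y + Y\<^sup>2) - S * (X * (2 * a + b) + Y * (a + 2 * b))"
        unfolding 0 by (simp add: power2_eq_square algebra_simps)
      also have "\<dots> = (S * S) * (X\<^sup>2 + X * Y + Y\<^sup>2) - (S * S) * X - (S * S) * Y"
        unfolding ab S_def[symmetric] by (simp add: algebra_simps)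
      also have "\<dots> = of_int ((i + j) * (i + j - 1) + i * (i - 1) + j * (j - 1)) / 2"
        unfolding S X_def Y_def by (simp add: power2_eq_square algebra_simps)
      finally show ?thesis .
    qed
    moreover have nn: "n * (n - 1) \<ge> 0" for n :: int
      by (cases "n \<ge> 1") (auto intro: mult_nonneg_nonneg mult_nonpos_nonpos)
    have "real_of_int ((i + j) * (i + j - 1) + i * (i - 1) + j * (j - 1)) \<ge> real_of_int 0"
      unfolding of_int_le_iff using nn[of "i + j"] nn[of i] nn[of j] by linarith
    ultimately show False by simp
  qed
qed

text \<open>The covering radius of the lattice is \<open>1 / sqrt 3\<close>: for a point of a closed unit triangle, the average of the
squared distances to the vertices, weighted with the barycentric coordinates, is at most \<open>1 / 3\<close>.\<close>
lemma vertex_near: "\<exists>q. (dist c (lattice_pt q))\<^sup>2 \<le> 1 / 3"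
proof -
  define i j where "i = frac (coord1 c)" and "j = frac (coord2 c)"
  define p where "p = (\<lfloor>coord1 c\<rfloor>, \<lfloor>coord2 c\<rfloor>)"
  have ij: "0 \<le> i" "i < 1" "0 \<le> j" "j < 1" by (simp_all add: i_def j_def frac_lt_1)
  have d: "(dist c (lattice_pt (p + (a, b))))\<^sup>2 = (i - of_int a)\<^sup>2 + (i - of_int a) * (j - of_int b) + (j - of_int b)\<^sup>2" for a b
    unfolding dist_norm norm_coords by (simp add: p_def i_def j_def frac_def algebra_simps)
  show ?thesis
  proof (rule ccontr)
    assume "\<nexists>q. (dist c (lattice_pt q))\<^sup>2 \<le> 1 / 3"
    hence far: "1 / 3 < (dist c (lattice_pt q))\<^sup>2" for q by (metis not_le)
    note f = far[of "p + (0, 0)", unfolded d] far[of "p + (1, 0)", unfolded d] far[of "p + (0, 1)", unfolded d] far[of "p + (1, 1)", unfolded d]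
    define A B C D where "A = i\<^sup>2 + i * j + j\<^sup>2" and "B = A - 2 * i - j + 1" and "C = A - i - 2 * j + 1" and "D = A - 3 * i - 3 * j + 3"
    have f': "1 / 3 < A" "1 / 3 < B" "1 / 3 < C" "1 / 3 < D"
      using f by (simp_all add: A_def B_def C_def D_def power2_eq_square algebra_simps)
    have contr: False
      if "x + y + z = - (p + q + r) / 2" "0 \<le> x" "0 \<le> y" "0 \<le> z" "0 < x \<or> 0 < y \<or> 0 < z" "0 \<le> p" "0 \<le> q" "0 \<le> r"
      for x y z p q r :: real
      using that by (simp add: field_simps; linarith)
    show False
    proof (cases "i + j \<le> 1")
      case True
      have "(1 - i - j) * (A - 1 / 3) + i * (B - 1 / 3) + j * (C - 1 / 3) = - ((i + j - 2 / 3)\<^sup>2 + (i - 1 / 3)\<^sup>2 + (j - 1 / 3)\<^sup>2) / 2"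
        by (simp add: A_def B_def C_def power2_eq_square algebra_simps add_divide_distrib diff_divide_distrib)
      moreover have "0 \<le> (1 - i - j) * (A - 1 / 3)" "0 \<le> i * (B - 1 / 3)" "0 \<le> j * (C - 1 / 3)"
        using ij True f' by (auto intro!: mult_nonneg_nonneg)
      moreover have "(1 - i - j) * (A - 1 / 3) > 0 \<or> i * (B - 1 / 3) > 0 \<or> j * (C - 1 / 3) > 0"
      proof -
        have "1 - i - j > 0 \<or> i > 0 \<or> j > 0" using ij by linarith
        thus ?thesis using f' by (auto intro!: mult_pos_pos)
      qed
      ultimately show False by (rule contr) simp_all
    next
      case False
      have eq: "(i + j - 1) * (D - 1 / 3) + (1 - j) * (B - 1 / 3) + (1 - i) * (C - 1 / 3) = - ((i + j - 4 / 3)\<^sup>2 + (i - 2 / 3)\<^sup>2 + (j - 2 / 3)\<^sup>2) / 2"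
        by (simp add: A_def B_def C_def D_def power2_eq_square algebra_simps add_divide_distrib diff_divide_distrib)
      have pos: "0 \<le> (i + j - 1) * (D - 1 / 3)" "0 < (1 - j) * (B - 1 / 3)" "0 < (1 - i) * (C - 1 / 3)"
        using ij False f' by (auto intro!: mult_nonneg_nonneg mult_pos_pos)
      have ex: "0 < (i + j - 1) * (D - 1 / 3) \<or> 0 < (1 - j) * (B - 1 / 3) \<or> 0 < (1 - i) * (C - 1 / 3)"
        using pos by blast
      show False
        by (rule contr[OF eq pos(1) less_imp_le[OF pos(2)] less_imp_le[OF pos(3)] ex zero_le_power2 zero_le_power2 zero_le_power2])
    qed
  qed
qed

lemma norm_pt: "(norm (lattice_pt p))\<^sup>2 = of_int ((fst p)\<^sup>2 + fst p * snd p + (snd p)\<^sup>2)"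
  by (simp add: norm_coords)

lemma unit_vectors:
  assumes "(norm (lattice_pt p))\<^sup>2 \<le> 4 / 3" "p \<noteq> 0"
  shows "p \<in> hexdirs"
proof -
  obtain a b where p: "p = (a, b)" by (cases p)
  have "real_of_int (a\<^sup>2 + a * b + b\<^sup>2) < of_int 2" using assms(1) unfolding norm_pt by (simp add: p)
  hence le: "a\<^sup>2 + a * b + b\<^sup>2 \<le> 1" by (simp only: of_int_less_iff)
  have "4 * (a\<^sup>2 + a * b + b\<^sup>2) = (2 * a + b)\<^sup>2 + 3 * b\<^sup>2" "4 * (a\<^sup>2 + a * b + b\<^sup>2) = (a + 2 * b)\<^sup>2 + 3 * a\<^sup>2"
    by (simp_all add: power2_eq_square algebra_simps)
  moreover have small: "3 * y \<le> 4" if "4 * n = x + 3 * y" "n \<le> 1" "0 \<le> x" for n x y :: int using that by linarith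
  ultimately have "3 * b\<^sup>2 \<le> 4" "3 * a\<^sup>2 \<le> 4" using le by (meson small zero_le_power2)+
  hence "b\<^sup>2 < 2\<^sup>2" "a\<^sup>2 < 2\<^sup>2" by simp_all
  hence "\<bar>a\<bar> < 2" "\<bar>b\<bar> < 2" using power_less_imp_less_base[of "\<bar>a\<bar>" 2 2] power_less_imp_less_base[of "\<bar>b\<bar>" 2 2] by simp_all
  hence "a \<in> {-1, 0, 1}" "b \<in> {-1, 0, 1}" by auto
  thus ?thesis using le assms(2) by (auto simp: p hexdirs_def zero_prod_def)
qed

lemma hexdirs_iff: "(a, b) \<in> hexdirs \<longleftrightarrow> (a = 1 \<and> b = 0) \<or> (a = -1 \<and> b = 0) \<or> (a = 0 \<and> b = 1)
    \<or> (a = 0 \<and> b = -1) \<or> (a = 1 \<and> b = -1) \<or> (a = -1 \<and> b = 1)"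
  by (simp add: hexdirs_def)

lemma hexdirs_triangle:
  assumes "d \<in> hexdirs" "d' \<in> hexdirs" "d' - d \<in> hexdirs"
  shows "\<exists>\<sigma>\<in>{1, -1}. \<exists>p. {lattice_pt a, lattice_pt (a + d), lattice_pt (a + d')} = unit_triangle \<sigma> p"
proof -
  define corner where "corner \<sigma> u v \<longleftrightarrow> (u, v) = ((\<sigma>, 0), (0, \<sigma>)) \<or> (u, v) = ((0, \<sigma>), (\<sigma>, 0))"
    for \<sigma> :: int and u v :: "int \<times> int"
  have tri: "{lattice_pt p, lattice_pt (p + u), lattice_pt (p + v)} = unit_triangle \<sigma> p" if "corner \<sigma> u v" for \<sigma> u v p
  proof -
    have "(u, v) = ((\<sigma>, 0), (0, \<sigma>)) \<or> (u, v) = ((0, \<sigma>), (\<sigma>, 0))" using that by (simp add: corner_def)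
    thus ?thesis unfolding unit_triangle_def by blast
  qed
  have corner_cases: "\<exists>\<sigma>\<in>{1, -1}. corner \<sigma> (x, y) (z, w) \<or> corner \<sigma> (- x, - y) (z - x, w - y)
      \<or> corner \<sigma> (- z, - w) (x - z, y - w)"
    if "(x, y) \<in> hexdirs" "(z, w) \<in> hexdirs" "(z - x, w - y) \<in> hexdirs" for x y z w
    using that unfolding hexdirs_iff corner_def prod.inject by (elim disjE conjE) simp_all
  have "\<exists>\<sigma>\<in>{1, -1}. corner \<sigma> d d' \<or> corner \<sigma> (- d) (d' - d) \<or> corner \<sigma> (- d') (d - d')"
    using corner_cases[of "fst d" "snd d" "fst d'" "snd d'"] assms by (cases d; cases d') simp
  then obtain \<sigma> where s: "\<sigma> \<in> {1, -1}"
    and "corner \<sigma> d d' \<or> corner \<sigma> (- d) (d' - d) \<or> corner \<sigma> (- d') (d - d')" by blast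
  then consider "corner \<sigma> d d'" | "corner \<sigma> (- d) (d' - d)" | "corner \<sigma> (- d') (d - d')" by blast
  hence "\<exists>p. {lattice_pt a, lattice_pt (a + d), lattice_pt (a + d')} = unit_triangle \<sigma> p"
  proof cases
    case 1 show ?thesis using tri[OF 1, of a] by blast
  next
    case 2
    have "{lattice_pt (a + d), lattice_pt a, lattice_pt (a + d')} = unit_triangle \<sigma> (a + d)" using tri[OF 2, of "a + d"] by simp
    thus ?thesis by (metis insert_commute)
  next
    case 3
    have "{lattice_pt (a + d'), lattice_pt a, lattice_pt (a + d)} = unit_triangle \<sigma> (a + d')" using tri[OF 3, of "a + d'"] by simp
    thus ?thesis by (metis insert_commute)
  qed
  thus ?thesis using s by blast
qed

lemma circumcentre_exists:
  fixes P Q :: "real^2"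
  assumes "P $ 1 * Q $ 2 - P $ 2 * Q $ 1 \<noteq> 0"
  shows "\<exists>c r. {a, a + P, a + Q} \<subseteq> sphere c r"
proof -
  define D where "D = P $ 1 * Q $ 2 - P $ 2 * Q $ 1"
  define u v where "u = (norm P)\<^sup>2 / 2" and "v = (norm Q)\<^sup>2 / 2"
  define c :: "real^2" where "c = vector [(u * Q $ 2 - v * P $ 2) / D, (v * P $ 1 - u * Q $ 1) / D]"
  have D: "D \<noteq> 0" using assms by (simp add: D_def)
  have cP: "P \<bullet> c = u" and cQ: "Q \<bullet> c = v"
    using D by (simp_all add: c_def inner_vec_def sum_2 field_simps) (simp_all add: D_def algebra_simps)
  have "dist (a + c) (a + z) = norm c" if "z \<bullet> c = (norm z)\<^sup>2 / 2" for z
  proof -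
    have "(norm (c - z))\<^sup>2 = (norm c)\<^sup>2"
      using that by (simp add: power2_norm_eq_inner inner_diff_left inner_diff_right inner_commute)
    thus ?thesis by (simp add: dist_norm)
  qed
  from this[of P] this[of Q] this[of 0] have "{a, a + P, a + Q} \<subseteq> sphere (a + c) (norm c)"
    using cP cQ by (simp add: u_def v_def)
  thus ?thesis by blast
qed

lemma flat_triangle_empty:
  fixes P Q :: "real^2"
  assumes "P $ 1 * Q $ 2 - P $ 2 * Q $ 1 = 0" "P \<noteq> 0"
  shows "open_triangle {a, a + P, a + Q} = {}"
proof -
  define n :: "real^2" where "n = vector [- P $ 2, P $ 1]"
  have n: "n \<noteq> 0" using assms(2) by (auto simp: n_def vec_eq_iff forall_2)
  have "n \<bullet> P = 0" "n \<bullet> Q = 0" using assms(1) by (simp_all add: n_def inner_vec_def sum_2 algebra_simps)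
  hence "{a, a + P, a + Q} \<subseteq> {x. n \<bullet> x = n \<bullet> a}" by (simp add: inner_add_right)
  hence "convex hull {a, a + P, a + Q} \<subseteq> {x. n \<bullet> x = n \<bullet> a}" by (rule hull_minimal) (rule convex_hyperplane)
  hence "interior (convex hull {a, a + P, a + Q}) \<subseteq> interior {x. n \<bullet> x = n \<bullet> a}" by (rule interior_mono)
  thus ?thesis using n by (simp add: open_triangle_def)
qed

text \<open>The circumscribed disc of a Delaunay triangle contains no lattice point, so its radius is at most the
covering radius. Then the squared side lengths are at most \<open>4 / 3\<close>, and the only such nonzero lattice
vectors are the unit vectors.\<close>
lemma delaunay_triangle_unit:
  assumes T: "triangulation (lattice 1) T" "delaunay (lattice 1) T" and V: "V \<in> T"
  shows "V \<in> unit_triangles"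
proof -
  from T(1) V have "V \<subseteq> lattice 1" "card V = 3" and ne: "open_triangle V \<noteq> {}" by (auto simp: triangulation_def)
  then obtain x y z where Vx: "V = {x, y, z}" "x \<noteq> y" "x \<noteq> z" "y \<noteq> z" by (auto simp: card_3_iff)
  with \<open>V \<subseteq> lattice 1\<close> obtain a b c where "x = lattice_pt a" "y = lattice_pt b" "z = lattice_pt c" by (auto simp: lattice_eq)
  with Vx have Veq: "V = {lattice_pt a, lattice_pt b, lattice_pt c}" and ne3: "a \<noteq> b" "a \<noteq> c" "b \<noteq> c" by auto
  define P Q where "P = lattice_pt b - lattice_pt a" and "Q = lattice_pt c - lattice_pt a"
  have V': "V = {lattice_pt a, lattice_pt a + P, lattice_pt a + Q}" by (simp add: Veq P_def Q_def)
  have "P \<noteq> 0" using ne3 by (simp add: P_def)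
  with ne have "P $ 1 * Q $ 2 - P $ 2 * Q $ 1 \<noteq> 0" unfolding V' using flat_triangle_empty by blast
  then obtain o' r where o: "V \<subseteq> sphere o' r" unfolding V' using circumcentre_exists by blast
  hence "ball o' r \<inter> lattice 1 = {}" using T(2) V by (auto simp: delaunay_def)
  moreover obtain q where q: "(dist o' (lattice_pt q))\<^sup>2 \<le> 1 / 3" using vertex_near by blast
  ultimately have "lattice_pt q \<notin> ball o' r" by (auto simp: lattice_eq)
  hence "r \<le> dist o' (lattice_pt q)" by simp
  moreover have r0: "0 \<le> r" using o unfolding Veq by auto
  ultimately have "r\<^sup>2 \<le> (dist o' (lattice_pt q))\<^sup>2" by (intro power_mono)
  with q have r: "r\<^sup>2 \<le> 1 / 3" by linarith
  have near: "q - p \<in> hexdirs" if "lattice_pt p \<in> V" "lattice_pt q \<in> V" "p \<noteq> q" for p q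
  proof (rule unit_vectors)
    have "dist o' (lattice_pt p) = r" "dist o' (lattice_pt q) = r" using o that by auto
    hence "norm (lattice_pt (q - p)) \<le> 2 * r"
      using dist_triangle2[of "lattice_pt q" "lattice_pt p" o'] by (simp add: lattice_pt_diff dist_norm norm_minus_commute)
    hence "(norm (lattice_pt (q - p)))\<^sup>2 \<le> (2 * r)\<^sup>2" by (rule power_mono) simp
    thus "(norm (lattice_pt (q - p)))\<^sup>2 \<le> 4 / 3" using r by (simp add: power_mult_distrib)
  qed (use that in auto)
  have "\<exists>\<sigma>\<in>{1, -1}. \<exists>p. {lattice_pt a, lattice_pt (a + (b - a)), lattice_pt (a + (c - a))} = unit_triangle \<sigma> p"
  proof (rule hexdirs_triangle)
    show "b - a \<in> hexdirs" "c - a \<in> hexdirs" using near[of a b] near[of a c] ne3 by (auto simp: Veq)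
    show "c - a - (b - a) \<in> hexdirs" using near[of b c] ne3 by (auto simp: Veq)
  qed
  thus ?thesis by (auto simp: Veq unit_triangles_def)
qed

text \<open>A unit triangle missing from \<open>T\<close> would have to be covered by closures of other unit triangles.\<close>
lemma delaunay_triangulation_unique:
  assumes T: "triangulation (lattice 1) T" "delaunay (lattice 1) T"
  shows "T = unit_triangles"
proof
  show sub: "T \<subseteq> unit_triangles" using delaunay_triangle_unit[OF T] by blast
  have U: "open_triangle V \<noteq> {}" "W \<in> unit_triangles \<Longrightarrow> V \<noteq> W \<Longrightarrow> open_triangle V \<inter> open_triangle W = {}"
    if "V \<in> unit_triangles" for V W
    using triangulation_unit that unfolding triangulation_def by meson+
  show "unit_triangles \<subseteq> T"
  proof
    fix W assume W: "W \<in> unit_triangles"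
    then obtain x where x: "x \<in> open_triangle W" using U(1)[OF W] by blast
    have "(\<Union>V\<in>T. closure (open_triangle V)) = UNIV" using T(1) unfolding triangulation_def by meson
    then obtain V where V: "V \<in> T" "x \<in> closure (open_triangle V)" by blast
    have "open (open_triangle W)" unfolding open_triangle_def by (rule open_interior)
    hence "open_triangle W \<inter> open_triangle V \<noteq> {}"
      using x V(2) open_Int_closure_eq_empty[of "open_triangle W" "open_triangle V"] by blast
    hence "W = V" using U(2)[OF W, of V] sub V(1) by blast
    thus "W \<in> T" using V(1) by simp
  qed
qed

text \<open>For \<open>\<rho> = 1\<close> no four points \<open>P_pt i\<close>, \<open>P_pt (i + 1)\<close>, \<open>Q_pt 1 j\<close>, \<open>Q_pt 1 (j + 1)\<close> are concyclic: the
perpendicular bisectors of the two parallel segments are distinct.\<close>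
lemma tie_free: "tie_convention 1 T"
  unfolding tie_convention_def
proof (intro allI impI, elim exE)
  fix i j :: int and c r
  assume s: "{P_pt i, P_pt (i + 1), Q_pt 1 j, Q_pt 1 (j + 1)} \<subseteq> sphere c r"
  have "P_pt i = lattice_pt (-1, i)" "P_pt (i + 1) = lattice_pt (-1, i + 1)" "Q_pt 1 j = lattice_pt (0, j)" "Q_pt 1 (j + 1) = lattice_pt (0, j + 1)"
    by (simp_all add: P_pt_def Q_pt_def lattice_pt_def)
  with s have *: "dist c (lattice_pt (-1, i)) = r" "dist c (lattice_pt (-1, i + 1)) = r" "dist c (lattice_pt (0, j)) = r" "dist c (lattice_pt (0, j + 1)) = r"
    by simp_all
  have d: "(dist c (lattice_pt q))\<^sup>2 = (coord1 c - of_int (fst q))\<^sup>2 + (coord1 c - of_int (fst q)) * (coord2 c - of_int (snd q)) + (coord2 c - of_int (snd q))\<^sup>2" for q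
    unfolding dist_norm norm_coords by simp
  have "(dist c (lattice_pt (-1, i)))\<^sup>2 = (dist c (lattice_pt (-1, i + 1)))\<^sup>2" "(dist c (lattice_pt (0, j)))\<^sup>2 = (dist c (lattice_pt (0, j + 1)))\<^sup>2"
    by (simp_all only: *)
  hence "2 * coord2 c + coord1 c = 2 * of_int i" "2 * coord2 c + coord1 c = 2 * of_int j + 1"
    unfolding d by (simp_all add: power2_eq_square algebra_simps)
  hence "real_of_int (2 * i) = real_of_int (2 * j + 1)" by simp
  hence "2 * i = 2 * j + 1" by (simp only: of_int_eq_iff)
  hence False by presburger
  thus "{P_pt i, Q_pt 1 j, Q_pt 1 (j + 1)} \<in> T \<and> {P_pt i, P_pt (i + 1), Q_pt 1 (j + 1)} \<in> T" ..
qed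

lemma lattice_triangulation_1: "lattice_triangulation 1 = unit_triangles"
  unfolding lattice_triangulation_def
  using triangulation_unit delaunay_unit tie_free delaunay_triangulation_unique by (intro the_equality) auto

lemma nearest_neighbours_pt: "nearest_neighbours 1 (lattice_pt p) (lattice_pt q) \<longleftrightarrow> q - p \<in> hexdirs"
proof
  assume "nearest_neighbours 1 (lattice_pt p) (lattice_pt q)"
  then obtain \<sigma> r where "p \<noteq> q" "\<sigma> \<in> {1, -1}" "lattice_pt p \<in> unit_triangle \<sigma> r" "lattice_pt q \<in> unit_triangle \<sigma> r"
    by (auto simp: nearest_neighbours_def lattice_triangulation_1 unit_triangles_def)
  thus "q - p \<in> hexdirs" by (cases r) (auto simp: unit_triangle_def hexdirs_def)
next
  assume h: "q - p \<in> hexdirs"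
  define d where "d = q - p"
  have q: "q = p + d" by (simp add: d_def)
  have "\<exists>\<sigma>\<in>{1, -1}. \<exists>r. lattice_pt p \<in> unit_triangle \<sigma> r \<and> lattice_pt q \<in> unit_triangle \<sigma> r"
  proof -
    have "d \<in> hexdirs" using h by (simp add: d_def)
    then consider "d = (1, 0) \<or> d = (0, 1)" | "d = (-1, 0) \<or> d = (0, -1)" | "d = (1, -1)" | "d = (-1, 1)" by (auto simp: hexdirs_def)
    thus ?thesis
    proof cases
      case 1 thus ?thesis by (intro bexI[of _ 1] exI[of _ p]) (auto simp: unit_triangle_def q)
    next
      case 2 thus ?thesis by (intro bexI[of _ "-1"] exI[of _ p]) (auto simp: unit_triangle_def q)
    next
      case 3 thus ?thesis by (intro bexI[of _ 1] exI[of _ "p + (0, -1)"]) (cases p, auto simp: unit_triangle_def q)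
    next
      case 4 thus ?thesis by (intro bexI[of _ 1] exI[of _ "p + (-1, 0)"]) (cases p, auto simp: unit_triangle_def q)
    qed
  qed
  moreover have "p \<noteq> q" using h by (auto simp: hexdirs_def zero_prod_def)
  ultimately show "nearest_neighbours 1 (lattice_pt p) (lattice_pt q)"
    by (auto simp: nearest_neighbours_def lattice_triangulation_1 unit_triangles_def)
qed

section \<open>The energy as a sum over bonds\<close>

lemma strip_coords: "strip k = {x. 0 < coord2 x \<and> coord2 x < real k}"
proof -
  have "0 < sqrt 3 / 2 * coord2 x \<longleftrightarrow> 0 < coord2 x" "sqrt 3 / 2 * coord2 x < sqrt 3 / 2 * real k \<longleftrightarrow> coord2 x < real k" for x
    by (simp_all add: zero_less_mult_iff)
  thus ?thesis unfolding strip_def comp_coords by blast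
qed

lemma closure_strip:
  assumes "1 \<le> k"
  shows "closure (strip k) = {x. 0 \<le> coord2 x \<and> coord2 x \<le> real k}"
proof -
  define S :: "(real^2) set" where "S = {x. x $ 2 \<ge> 0} \<inter> {x. x $ 2 \<le> sqrt 3 / 2 * real k}"
  have i: "interior S = strip k" unfolding S_def interior_Int interior_halfspace_component_le interior_halfspace_component_ge
    by (auto simp only: strip_def)
  have "convex S"
  proof (rule convexI)
    fix x y :: "real^2" and a b :: real
    assume "x \<in> S" "y \<in> S" and ab: "0 \<le> a" "0 \<le> b" "a + b = 1"
    hence "0 \<le> x $ 2" "x $ 2 \<le> sqrt 3 / 2 * real k" "0 \<le> y $ 2" "y $ 2 \<le> sqrt 3 / 2 * real k"
      unfolding S_def by blast+
    hence "0 \<le> a * x $ 2 + b * y $ 2" "a * x $ 2 + b * y $ 2 \<le> sqrt 3 / 2 * real k"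
      using ab convex_bound_le[of "x $ 2" "sqrt 3 / 2 * real k" "y $ 2" a b] by simp_all
    thus "a *\<^sub>R x + b *\<^sub>R y \<in> S" unfolding S_def by simp
  qed
  moreover have "(1/2) *\<^sub>R w2 \<in> strip k" using assms by (simp add: strip_coords)
  ultimately have "closure (strip k) = closure S" using convex_closure_interior[of S] i by auto
  also have "\<dots> = S" unfolding S_def
    by (intro closure_closed closed_Int closed_halfspace_component_le_cart closed_halfspace_component_ge_cart)
  also have "\<dots> = {x. 0 \<le> coord2 x \<and> coord2 x \<le> real k}" 
  proof -
    have "0 \<le> sqrt 3 / 2 * coord2 x \<longleftrightarrow> 0 \<le> coord2 x" "sqrt 3 / 2 * coord2 x \<le> sqrt 3 / 2 * real k \<longleftrightarrow> coord2 x \<le> real k" for x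
      by (simp_all add: zero_le_mult_iff)
    thus ?thesis unfolding S_def comp_coords by blast
  qed
  finally show ?thesis .
qed

text \<open>The bonds in the closed strip, as ordered pairs of indices.\<close>
definition strip_bonds :: "nat \<Rightarrow> ((int \<times> int) \<times> (int \<times> int)) set" where
  "strip_bonds k = {(p, q). q - p \<in> hexdirs \<and> snd p \<in> {0..int k} \<and> snd q \<in> {0..int k}}"

text \<open>Twice the contribution of an ordered bond to the energy.\<close>
definition bond_energy :: "real \<Rightarrow> (real^2 \<Rightarrow> real^2) \<Rightarrow> (int \<times> int) \<times> (int \<times> int) \<Rightarrow> real" where
  "bond_energy lam u e = (norm (u (lattice_pt (fst e)) - u (lattice_pt (snd e))) - rest_length lam (fst e))\<^sup>2"

lemma bond_energy_nonneg [simp]: "0 \<le> bond_energy lam u e" by (simp add: bond_energy_def)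

lemma energy_edges:
  assumes "1 \<le> k"
  shows "energy lam u 1 k = (1/2) * (\<Sum>\<^sub>\<infinity>e\<in>strip_bonds k. ennreal (bond_energy lam u e))"
proof -
  define f where "f = map_prod lattice_pt lattice_pt"
  have inj: "inj_on f A" for A unfolding f_def by (auto simp: inj_on_def)
  define M P where "M = {e \<in> strip_bonds k. fst (fst e) < 0}" and "P = {e \<in> strip_bonds k. \<not> fst (fst e) < 0}"
  have cl: "lattice_pt p \<in> closure (strip k) \<longleftrightarrow> snd p \<in> {0..int k}" for p
    unfolding closure_strip[OF assms] using of_int_le_iff[of "snd p" "int k", where ?'a = real] by simp
  have sl: "lattice_pt p \<in> strip_lattice 1 k \<longleftrightarrow> snd p \<in> {0..int k}" for p
    using cl by (auto simp: strip_lattice_def lattice_eq)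
  have sm: "lattice_pt p \<in> strip_lattice_minus k \<longleftrightarrow> fst p < 0 \<and> snd p \<in> {0..int k}" for p
    using cl by (auto simp: strip_lattice_minus_def lattice_minus_eq)
  have sp: "lattice_pt p \<in> strip_lattice_plus 1 k \<longleftrightarrow> \<not> fst p < 0 \<and> snd p \<in> {0..int k}" for p
    using cl by (auto simp: strip_lattice_plus_def lattice_plus_eq)
  have M: "{(x, y). nearest_neighbours 1 x y \<and> x \<in> strip_lattice_minus k \<and> y \<in> strip_lattice 1 k} = f ` M"
  proof (rule set_eqI, rule iffI)
    fix e assume e: "e \<in> {(x, y). nearest_neighbours 1 x y \<and> x \<in> strip_lattice_minus k \<and> y \<in> strip_lattice 1 k}"
    then obtain p q where pq: "e = (lattice_pt p, lattice_pt q)"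
      by (auto simp: strip_lattice_minus_def strip_lattice_def lattice_minus_eq lattice_eq)
    have "(p, q) \<in> M" using e by (simp add: pq M_def strip_bonds_def nearest_neighbours_pt sm sl)
    thus "e \<in> f ` M" unfolding pq f_def by force
  next
    fix e assume "e \<in> f ` M"
    thus "e \<in> {(x, y). nearest_neighbours 1 x y \<and> x \<in> strip_lattice_minus k \<and> y \<in> strip_lattice 1 k}"
      by (auto simp: f_def M_def strip_bonds_def nearest_neighbours_pt sm sl)
  qed
  have P: "{(x, y). nearest_neighbours 1 x y \<and> x \<in> strip_lattice_plus 1 k \<and> y \<in> strip_lattice 1 k} = f ` P"
  proof (rule set_eqI, rule iffI)
    fix e assume e: "e \<in> {(x, y). nearest_neighbours 1 x y \<and> x \<in> strip_lattice_plus 1 k \<and> y \<in> strip_lattice 1 k}"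
    then obtain p q where pq: "e = (lattice_pt p, lattice_pt q)"
      by (auto simp: strip_lattice_plus_def strip_lattice_def lattice_plus_eq lattice_eq)
    have "(p, q) \<in> P" using e by (simp add: pq P_def strip_bonds_def nearest_neighbours_pt sp sl)
    thus "e \<in> f ` P" unfolding pq f_def by force
  next
    fix e assume "e \<in> f ` P"
    thus "e \<in> {(x, y). nearest_neighbours 1 x y \<and> x \<in> strip_lattice_plus 1 k \<and> y \<in> strip_lattice 1 k}"
      by (auto simp: f_def P_def strip_bonds_def nearest_neighbours_pt sp sl)
  qed
  have "energy lam u 1 k = (1/2) * (\<Sum>\<^sub>\<infinity>e\<in>M. ennreal (bond_energy lam u e)) + (1/2) * (\<Sum>\<^sub>\<infinity>e\<in>P. ennreal (bond_energy lam u e))"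
    unfolding energy_def M P infsum_reindex[OF inj]
    by (intro arg_cong2[where f = plus] arg_cong2[where f = times] refl infsum_cong)
       (auto simp: f_def M_def P_def bond_energy_def rest_length_def)
  also have "\<dots> = (1/2) * (\<Sum>\<^sub>\<infinity>e\<in>M \<union> P. ennreal (bond_energy lam u e))"
    by (subst infsum_Un_disjoint) (auto simp: M_def P_def distrib_left intro!: nonneg_summable_on_complete)
  also have "M \<union> P = strip_bonds k" by (auto simp: M_def P_def)
  finally show ?thesis .
qed

lemma half_ennreal: "0 \<le> a \<Longrightarrow> (1/2) * ennreal a = ennreal (a / 2)"
  by (metis divide_ennreal ennreal_divide_times ennreal_numeral mult_1 zero_less_numeral zero_le_numeral)

lemma energy_ge:
  assumes "1 \<le> k" "finite F" "F \<subseteq> strip_bonds k"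
  shows "ennreal ((\<Sum>e\<in>F. bond_energy lam u e) / 2) \<le> energy lam u 1 k"
proof -
  have "ennreal ((\<Sum>e\<in>F. bond_energy lam u e) / 2) = (1/2) * (\<Sum>e\<in>F. ennreal (bond_energy lam u e))"
    by (simp add: half_ennreal sum_nonneg)
  also have "(\<Sum>e\<in>F. ennreal (bond_energy lam u e)) \<le> (\<Sum>\<^sub>\<infinity>e\<in>strip_bonds k. ennreal (bond_energy lam u e))"
    unfolding nonneg_infsum_complete[OF zero_le] by (rule SUP_upper) (use assms in auto)
  finally show ?thesis unfolding energy_edges[OF assms(1)] by (simp add: mult_left_mono)
qed

lemma energy_finite:
  assumes "1 \<le> k" "finite F" "F \<subseteq> strip_bonds k" "\<And>e. e \<in> strip_bonds k - F \<Longrightarrow> bond_energy lam u e = 0"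
  shows "energy lam u 1 k = ennreal ((\<Sum>e\<in>F. bond_energy lam u e) / 2)"
proof -
  have "(\<Sum>\<^sub>\<infinity>e\<in>strip_bonds k. ennreal (bond_energy lam u e)) = (\<Sum>\<^sub>\<infinity>e\<in>F. ennreal (bond_energy lam u e))"
    by (rule infsum_cong_neutral) (use assms in auto)
  thus ?thesis unfolding energy_edges[OF assms(1)] using assms(2) by (simp add: half_ennreal sum_nonneg)
qed

section \<open>The lower bound\<close>

text \<open>The identification of the plane with the complex numbers.\<close>
definition cplx :: "real^2 \<Rightarrow> complex" where "cplx x = Complex (x $ 1) (x $ 2)"

lemma norm_cplx_diff: "norm (cplx x - cplx y) = norm (x - y)"
  by (simp add: cplx_def cmod_def norm_vec_def L2_set_def sum_2)

text \<open>On a triangle an admissible deformation is affine with linear part \<open>A\<close>. The triangle has positive measure,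
so \<open>det A > 0\<close> holds at some point of it; by continuity the affine formula extends to the vertices.\<close>
lemma admissible_oriented:
  assumes u: "u \<in> admissible 1 k" and k: "1 \<le> k" and s: "\<sigma> \<in> {1, -1}"
    and rows: "snd p \<in> {0..int k}" "snd p + \<sigma> \<in> {0..int k}"
  shows "cross2 (cplx (u (lattice_pt (p + (\<sigma>, 0)))) - cplx (u (lattice_pt p))) (cplx (u (lattice_pt (p + (0, \<sigma>)))) - cplx (u (lattice_pt p))) > 0"
proof -
  define O1 where "O1 = open_triangle (unit_triangle \<sigma> p)"
  have O1: "open O1" "convex O1" "O1 \<noteq> {}"
    using open_triangle_unit_triangle_nonempty[OF s] by (auto simp: O1_def open_triangle_def)
  have rows': "0 \<le> real_of_int (snd p)" "real_of_int (snd p) \<le> real k"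
     "0 \<le> real_of_int (snd p) + of_int \<sigma>" "real_of_int (snd p) + of_int \<sigma> \<le> real k"
    using rows by (simp_all flip: of_int_add add: of_int_le_iff[of _ "int k", where ?'a = real, simplified])
  have sub: "O1 \<subseteq> strip k"
    unfolding O1_def open_triangle_unit_triangle[OF s] strip_coords using s rows' by auto
  have "unit_triangle \<sigma> p \<in> lattice_triangulation 1" using s unfolding lattice_triangulation_1 unit_triangles_def by blast
  then obtain A :: "real^2^2" where A: "\<And>x. x \<in> O1 \<Longrightarrow> (u has_derivative (\<lambda>h. A *v h)) (at x)"
    using u sub unfolding admissible_def O1_def by blast
  have "\<exists>c. \<forall>x\<in>O1. u x - A *v x = c"
  proof (rule has_derivative_zero_constant[OF O1(2)])
    fix x assume "x \<in> O1"
    have "((\<lambda>x. A *v x) has_derivative (\<lambda>h. A *v h)) (at x)"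
      by (intro bounded_linear_imp_has_derivative linear_conv_bounded_linear[THEN iffD1] matrix_vector_mul_linear)
    from has_derivative_diff[OF A[OF \<open>x \<in> O1\<close>] this]
    show "((\<lambda>x. u x - A *v x) has_derivative (\<lambda>h. 0)) (at x within O1)"
      by (simp add: has_derivative_at_withinI)
  qed
  then obtain c where c: "\<And>x. x \<in> O1 \<Longrightarrow> u x - A *v x = c" by blast
  have clo: "closure O1 \<subseteq> closure (strip k)" by (rule closure_mono[OF sub])
  have cc: "u x - A *v x = c" if "x \<in> closure O1" for x
  proof (rule continuous_constant_on_closure[OF _ c that])
    show "continuous_on (closure O1) (\<lambda>x. u x - A *v x)"
    proof (rule continuous_on_diff)
      show "continuous_on (closure O1) u"
        using u clo unfolding admissible_def by (blast intro: continuous_on_subset)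
      show "continuous_on (closure O1) (\<lambda>x. A *v x)"
        by (intro linear_continuous_on linear_conv_bounded_linear[THEN iffD1] matrix_vector_mul_linear)
    qed
  qed
  have "AE x in lebesgue. x \<in> strip k \<longrightarrow> det (jacobian u (at x)) > 0"
    using u by (simp add: admissible_def)
  then obtain N where N: "{x. \<not> (x \<in> strip k \<longrightarrow> det (jacobian u (at x)) > 0)} \<subseteq> N" "N \<in> null_sets lebesgue"
    by (auto elim!: AE_E simp: null_sets_def)
  have "\<not> negligible O1" using open_not_negligible[OF O1(1,3)] .
  hence "\<not> O1 \<subseteq> N" using N(2) negligible_subset by (auto simp: negligible_iff_null_sets)
  then obtain x where x: "x \<in> O1" "x \<notin> N" by blast
  hence "det (jacobian u (at x)) > 0" using N(1) sub by blast
  moreover have "jacobian u (at x) = A"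
    unfolding jacobian_def using frechet_derivative_at[OF A[OF x(1)], symmetric] by simp
  ultimately have detA: "det A > 0" by simp
  have V: "unit_triangle \<sigma> p \<subseteq> closure O1" unfolding O1_def closure_open_triangle_unit_triangle[OF s] by (rule hull_subset)
  have up: "u (lattice_pt q) = A *v lattice_pt q + c" if "lattice_pt q \<in> unit_triangle \<sigma> p" for q
    using cc[of "lattice_pt q"] V that by (auto simp: algebra_simps)
  have d1: "u (lattice_pt (p + (\<sigma>, 0))) - u (lattice_pt p) = A *v (of_int \<sigma> *\<^sub>R w1)"
    using up[of "p + (\<sigma>, 0)"] up[of p] by (simp add: unit_triangle_def lattice_pt_add matrix_vector_right_distrib) (simp add: lattice_pt_def)
  have d2: "u (lattice_pt (p + (0, \<sigma>))) - u (lattice_pt p) = A *v (of_int \<sigma> *\<^sub>R w2)"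
    using up[of "p + (0, \<sigma>)"] up[of p] by (simp add: unit_triangle_def lattice_pt_add matrix_vector_right_distrib) (simp add: lattice_pt_def)
  have cr: "cross2 (cplx a - cplx b) (cplx c - cplx b) = (a - b) $ 1 * (c - b) $ 2 - (a - b) $ 2 * (c - b) $ 1" for a b c
    by (simp add: cross2_def cplx_def)
  have sg: "(real_of_int \<sigma>) * real_of_int \<sigma> = 1" using s by auto
  have eq: "(A *v (of_int \<sigma> *\<^sub>R w1)) $ 1 * (A *v (of_int \<sigma> *\<^sub>R w2)) $ 2 - (A *v (of_int \<sigma> *\<^sub>R w1)) $ 2 * (A *v (of_int \<sigma> *\<^sub>R w2)) $ 1
     = (real_of_int \<sigma> * real_of_int \<sigma>) * (det A * (sqrt 3 / 2))"
    by (simp add: matrix_vector_mult_def sum_2 w1_def w2_def det_2 algebra_simps)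
  thus ?thesis unfolding cr d1 d2 eq sg using detA by simp
qed

text \<open>No bond between the columns \<open>-1\<close> and \<open>0\<close> can have the lengths \<open>1\<close> and \<open>lam\<close> at the same time.\<close>
lemma energy_lower_interface:
  assumes k: "1 \<le> k" and lam: "0 < lam" "lam < 1"
  shows "ennreal ((1 - lam)\<^sup>2 / 4 * (real k + 1)) \<le> energy lam u 1 k"
proof -
  define a b :: "int \<Rightarrow> (int \<times> int) \<times> (int \<times> int)" where "a t = ((-1, t), (0, t))" and "b t = ((0, t), (-1, t))" for t
  define I where "I = {0..int k}"
  have sub: "a ` I \<union> b ` I \<subseteq> strip_bonds k" by (auto simp: a_def b_def I_def strip_bonds_def hexdirs_def)
  have inj: "inj_on a I" "inj_on b I" and dis: "a ` I \<inter> b ` I = {}" by (auto simp: a_def b_def inj_on_def)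
  have "(1 - lam)\<^sup>2 / 2 * (real k + 1) = (\<Sum>t\<in>I. (1 - lam)\<^sup>2 / 2)" by (simp add: I_def)
  also have "\<dots> \<le> (\<Sum>t\<in>I. bond_energy lam u (a t) + bond_energy lam u (b t))"
  proof (rule sum_mono)
    fix t
    define l where "l = norm (u (lattice_pt (-1, t)) - u (lattice_pt (0, t)))"
    have "(1 - lam)\<^sup>2 / 2 \<le> (l - 1)\<^sup>2 + (l - lam)\<^sup>2"
    proof -
      have "(l - 1)\<^sup>2 + (l - lam)\<^sup>2 = (1 - lam)\<^sup>2 / 2 + (2 * l - 1 - lam)\<^sup>2 / 2"
        by (simp add: power2_eq_square algebra_simps add_divide_distrib diff_divide_distrib)
      thus ?thesis by simp
    qed
    thus "(1 - lam)\<^sup>2 / 2 \<le> bond_energy lam u (a t) + bond_energy lam u (b t)"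
      by (simp add: bond_energy_def a_def b_def rest_length_def l_def norm_minus_commute)
  qed
  also have "\<dots> = (\<Sum>e\<in>a ` I \<union> b ` I. bond_energy lam u e)"
  proof -
    have "(\<Sum>e\<in>a ` I \<union> b ` I. bond_energy lam u e) = (\<Sum>e\<in>a ` I. bond_energy lam u e) + (\<Sum>e\<in>b ` I. bond_energy lam u e)"
      by (rule sum.union_disjoint) (simp_all add: dis, simp_all add: I_def)
    thus ?thesis by (simp add: sum.reindex[OF inj(1)] sum.reindex[OF inj(2)] sum.distrib)
  qed
  finally have "(1 - lam)\<^sup>2 / 4 * (real k + 1) \<le> (\<Sum>e\<in>a ` I \<union> b ` I. bond_energy lam u e) / 2"
    by (simp add: mult.commute)
  hence "ennreal ((1 - lam)\<^sup>2 / 4 * (real k + 1)) \<le> ennreal ((\<Sum>e\<in>a ` I \<union> b ` I. bond_energy lam u e) / 2)" by (rule ennreal_leI)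
  also have "\<dots> \<le> energy lam u 1 k" by (rule energy_ge[OF k _ sub]) (simp add: I_def)
  finally show ?thesis .
qed

lemma energy_lower_bulk:
  assumes k: "9 \<le> k" and lam: "0 < lam" "lam < 1" and u: "u \<in> admissible 1 k"
  shows "ennreal ((1 - lam\<^sup>2)\<^sup>2 / 576000000 * (real k)\<^sup>2) \<le> energy lam u 1 k"
proof -
  \<comment> \<open>The box of height \<open>4 * m\<close> is shifted up by two rows, such that all bonds starting in \<open>B\<close> stay in the strip.\<close>
  define m where "m = (int k - 5) div 4"
  have m: "1 \<le> m" "4 * m + 5 \<le> int k" "int k \<le> 12 * m" using k unfolding m_def by presburger+
  define U where "U p = cplx (u (lattice_pt (p + (0, 2))))" for p
  define B where "B = {-3 * m - 1..m + 2} \<times> {-1..4 * m + 2}"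
  define F where "F = (\<lambda>(x, e). (x + (0, 2), x + (0, 2) + e)) ` (B \<times> hexdirs)"
  have finB: "finite B" by (simp add: B_def)
  have finH: "finite hexdirs" by (simp add: hexdirs_def)
  have sub: "F \<subseteq> strip_bonds k"
    using m by (auto simp: F_def B_def strip_bonds_def hexdirs_def)
  have inj: "inj_on (\<lambda>(x, e). (x + (0, 2), x + (0, 2) + e)) (B \<times> hexdirs)"
    by (rule inj_onI) auto
  have "oriented_at U y" if y: "y \<in> {-3 * m - 1..m + 1} \<times> {-1..4 * m + 1}" for y
  proof -
    have b: "-1 \<le> snd y" "snd y \<le> 4 * m + 1" using y by auto
    have 1: "cross2 (cplx (u (lattice_pt (y + (0,2) + (1, 0)))) - cplx (u (lattice_pt (y + (0,2))))) (cplx (u (lattice_pt (y + (0,2) + (0, 1)))) - cplx (u (lattice_pt (y + (0,2))))) > 0"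
      by (rule admissible_oriented[OF u]) (use b m k in auto)
    have 2: "cross2 (cplx (u (lattice_pt (y + (1,3) + (-1, 0)))) - cplx (u (lattice_pt (y + (1,3))))) (cplx (u (lattice_pt (y + (1,3) + (0, -1)))) - cplx (u (lattice_pt (y + (1,3))))) > 0"
      by (rule admissible_oriented[OF u]) (use b m k in auto)
    show ?thesis using 1 2 by (cases y) (simp add: oriented_at_def U_def add.commute)
  qed
  hence "(1 - lam\<^sup>2)\<^sup>2 / 2000000 * (of_int m)\<^sup>2 \<le> (\<Sum>x\<in>B. star_energy lam U x)"
    unfolding B_def by (rule discrete_transition_bound[OF m(1) lam])
  also have "(\<Sum>x\<in>B. star_energy lam U x) = (\<Sum>(x, e)\<in>B \<times> hexdirs. bond_energy lam u (x + (0, 2), x + (0, 2) + e))"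
    unfolding star_energy_def sum.cartesian_product
    by (intro sum.cong refl) (auto simp: U_def norm_cplx_diff bond_energy_def rest_length_def ac_simps)
  also have "\<dots> = (\<Sum>e\<in>F. bond_energy lam u e)"
    unfolding F_def sum.reindex[OF inj] by (rule sum.cong) auto
  finally have S: "(1 - lam\<^sup>2)\<^sup>2 / 2000000 * (of_int m)\<^sup>2 \<le> (\<Sum>e\<in>F. bond_energy lam u e)" .
  have "real k \<le> 12 * of_int m" using m(3) by linarith
  hence "(real k)\<^sup>2 \<le> (12 * of_int m)\<^sup>2" by (rule power_mono) simp
  hence "(1 - lam\<^sup>2)\<^sup>2 / 576000000 * (real k)\<^sup>2 \<le> (1 - lam\<^sup>2)\<^sup>2 / 576000000 * (144 * (of_int m)\<^sup>2)"
    by (intro mult_left_mono) (simp_all add: power_mult_distrib)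
  also have "\<dots> = ((1 - lam\<^sup>2)\<^sup>2 / 2000000 * (of_int m)\<^sup>2) / 2" by simp
  also have "\<dots> \<le> (\<Sum>e\<in>F. bond_energy lam u e) / 2" by (rule divide_right_mono[OF S]) simp
  finally have "ennreal ((1 - lam\<^sup>2)\<^sup>2 / 576000000 * (real k)\<^sup>2) \<le> ennreal ((\<Sum>e\<in>F. bond_energy lam u e) / 2)" by (rule ennreal_leI)
  also have "\<dots> \<le> energy lam u 1 k"
    by (rule energy_ge[OF _ _ sub]) (use k finB finH in \<open>auto simp: F_def\<close>)
  finally show ?thesis .
qed

lemma energy_lower:
  assumes k: "1 \<le> k" and lam: "0 < lam" "lam < 1" and u: "u \<in> admissible 1 k"
  shows "ennreal (min ((1 - lam)\<^sup>2 / 32) ((1 - lam\<^sup>2)\<^sup>2 / 576000000) * (real k)\<^sup>2) \<le> energy lam u 1 k"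
proof (cases "9 \<le> k")
  case True
  have "ennreal (min ((1 - lam)\<^sup>2 / 32) ((1 - lam\<^sup>2)\<^sup>2 / 576000000) * (real k)\<^sup>2) \<le> ennreal ((1 - lam\<^sup>2)\<^sup>2 / 576000000 * (real k)\<^sup>2)"
    by (intro ennreal_leI mult_right_mono) auto
  also have "\<dots> \<le> energy lam u 1 k" by (rule energy_lower_bulk[OF True lam u])
  finally show ?thesis .
next
  case False
  have "min ((1 - lam)\<^sup>2 / 32) ((1 - lam\<^sup>2)\<^sup>2 / 576000000) * (real k)\<^sup>2 \<le> (1 - lam)\<^sup>2 / 32 * (8 * (real k + 1))"
  proof (rule mult_mono)
    show "(real k)\<^sup>2 \<le> 8 * (real k + 1)"
      using False mult_right_mono[of "real k" 8 "real k"] by (simp add: power2_eq_square)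
  qed auto
  also have "\<dots> = (1 - lam)\<^sup>2 / 4 * (real k + 1)" by simp
  finally have "ennreal (min ((1 - lam)\<^sup>2 / 32) ((1 - lam\<^sup>2)\<^sup>2 / 576000000) * (real k)\<^sup>2) \<le> ennreal ((1 - lam)\<^sup>2 / 4 * (real k + 1))"
    by (rule ennreal_leI)
  also have "\<dots> \<le> energy lam u 1 k" by (rule energy_lower_interface[OF k lam])
  finally show ?thesis .
qed

section \<open>The upper bound\<close>

text \<open>For a point at height \<open>t \<ge> 0\<close>, the ramp equals \<open>t\<close> as long as \<open>s + t \<le> k\<close>, then decreases to \<open>0\<close> at \<open>s = k\<close>
and stays \<open>0\<close>. All its creases in the upper half-plane are along lattice lines.\<close>
definition ramp :: "nat \<Rightarrow> real^2 \<Rightarrow> real" where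
  "ramp k x = max 0 (min (coord2 x) (real k - coord1 x))"

text \<open>The test deformation. Within the strip it is the identity for \<open>s \<le> 0\<close> and \<open>lam\<close> times the identity for
\<open>s \<ge> k\<close>, and its gradient jumps only across the lines \<open>s = 0\<close>, \<open>s = k\<close> and \<open>s + t = k\<close>, which do not meet
the open triangles.\<close>
definition compression :: "real \<Rightarrow> nat \<Rightarrow> real^2 \<Rightarrow> real^2" where
  "compression lam k x = min (coord1 x) (lam * coord1 x) *\<^sub>R w1 + (lam * coord2 x + (1 - lam) * ramp k x) *\<^sub>R w2"

text \<open>Linear maps given in the basis \<open>w1\<close>, \<open>w2\<close> by a lower triangular matrix.\<close>
definition coord_map :: "real \<Rightarrow> real \<Rightarrow> real \<Rightarrow> real^2 \<Rightarrow> real^2" where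
  "coord_map \<alpha> \<beta> \<gamma> x = (\<alpha> * coord1 x) *\<^sub>R w1 + (\<beta> * coord1 x + \<gamma> * coord2 x) *\<^sub>R w2"

lemma linear_lin: "linear (coord_map \<alpha> \<beta> \<gamma>)"
  by (rule linearI) (simp_all add: coord_map_def algebra_simps)

lemma coord_map_id: "coord_map 1 0 1 = (\<lambda>x. x)"
  using coords_expand by (auto simp: coord_map_def)

lemma coord_map_scale: "coord_map c 0 c = (\<lambda>x. c *\<^sub>R x)"
proof
  fix x show "coord_map c 0 c x = c *\<^sub>R x" by (rule coords_eqI) (simp_all add: coord_map_def)
qed

lemma matrix_lin: "matrix (coord_map \<alpha> \<beta> \<gamma>) *v h = coord_map \<alpha> \<beta> \<gamma> h"
  by (rule matrix_works) (simp add: linear_matrix_vector_mul_eq linear_lin)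

lemma det_matrix_lin: "det (matrix (coord_map \<alpha> \<beta> \<gamma>)) = \<alpha> * \<gamma>"
proof -
  have "coord1 (axis 1 1) = 1" "coord1 (axis 2 1) = - 1 / sqrt 3" "coord2 (axis 1 1) = 0" "coord2 (axis 2 1) = 2 / sqrt 3"
    by (simp_all add: coord1_def coord2_def axis_def)
  thus ?thesis
    by (simp add: det_2 matrix_def coord_map_def w1_def w2_def field_simps)
qed

lemma continuous_coords: "continuous_on S coord1" "continuous_on S coord2"
  using linear_sc linear_tc by (simp_all add: linear_continuous_on linear_conv_bounded_linear[THEN iffD1])

lemma continuous_comp_map: "continuous_on S (compression lam k)"
  unfolding compression_def ramp_def by (intro continuous_intros continuous_coords)

lemma compression_derivative:
  assumes t: "0 < coord2 x" and s: "coord1 x \<noteq> 0" "coord1 x \<noteq> real k" "coord1 x + coord2 x \<noteq> real k" and lam: "0 < lam" "lam < 1"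
  defines "\<alpha> \<equiv> if coord1 x < 0 then 1 else lam"
  defines "\<beta> \<equiv> if real k < coord1 x then 0 else if real k < coord1 x + coord2 x then lam - 1 else 0"
  defines "\<gamma> \<equiv> if real k < coord1 x then lam else if real k < coord1 x + coord2 x then lam else 1"
  shows "(compression lam k has_derivative coord_map \<alpha> \<beta> \<gamma>) (at x)"
proof -
  define c where "c = (if \<not> real k < coord1 x \<and> real k < coord1 x + coord2 x then (1 - lam) * real k else 0)"
  define S where "S = (if coord1 x < 0 then {y. coord1 y < 0} else {y. 0 < coord1 y}) \<inter> {y. 0 < coord2 y} \<inter>
     (if real k < coord1 x then {y. real k < coord1 y} else {y. coord1 y < real k}) \<inter>
     (if real k < coord1 x + coord2 x then {y. real k < coord1 y + coord2 y} else {y. coord1 y + coord2 y < real k})"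
  have "open S" unfolding S_def
    by (intro open_Int; auto intro!: open_Collect_less continuous_intros continuous_coords)
  moreover have "x \<in> S" using t s by (auto simp: S_def)
  moreover have "compression lam k y = coord_map \<alpha> \<beta> \<gamma> y + c *\<^sub>R w2" if "y \<in> S" for y
  proof -
    have y: "0 < coord2 y" "coord1 x < 0 \<longleftrightarrow> coord1 y < 0" "real k < coord1 x \<longleftrightarrow> real k < coord1 y" "real k < coord1 x + coord2 x \<longleftrightarrow> real k < coord1 y + coord2 y"
      using that by (auto simp: S_def split: if_splits)
    have "min (coord1 y) (lam * coord1 y) = \<alpha> * coord1 y"
    proof (cases "coord1 y < 0")
      case True thus ?thesis using mult_right_mono_neg[of lam 1 "coord1 y"] lam by (simp add: \<alpha>_def y min_def)
    next
      case False thus ?thesis using mult_right_mono[of lam 1 "coord1 y"] lam by (simp add: \<alpha>_def y min_def)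
    qed
    moreover have "lam * coord2 y + (1 - lam) * ramp k y = \<beta> * coord1 y + \<gamma> * coord2 y + c"
    proof -
      consider "real k < coord1 y" | "\<not> real k < coord1 y" "real k < coord1 y + coord2 y" | "\<not> real k < coord1 y" "\<not> real k < coord1 y + coord2 y" by blast
      thus ?thesis
      proof cases
        case 1
        hence "ramp k y = 0" by (simp add: ramp_def)
        thus ?thesis using 1 by (simp add: \<beta>_def \<gamma>_def c_def y)
      next
        case 2
        hence r: "ramp k y = real k - coord1 y" by (simp add: ramp_def)
        show ?thesis unfolding r using 2 by (simp add: \<beta>_def \<gamma>_def c_def y algebra_simps)
      next
        case 3
        hence "ramp k y = coord2 y" using y(1) by (simp add: ramp_def)
        thus ?thesis using 3 by (simp add: \<beta>_def \<gamma>_def c_def y algebra_simps)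
      qed
    qed
    ultimately show ?thesis by (simp add: compression_def coord_map_def algebra_simps)
  qed
  moreover have "((\<lambda>y. coord_map \<alpha> \<beta> \<gamma> y + c *\<^sub>R w2) has_derivative coord_map \<alpha> \<beta> \<gamma>) (at x)"
    by (intro has_derivative_add_const bounded_linear_imp_has_derivative linear_conv_bounded_linear[THEN iffD1] linear_lin)
  ultimately show ?thesis by (metis (no_types, lifting) has_derivative_transform_within_open)
qed

lemma negligible_coord_line:
  assumes "a \<noteq> 0 \<or> b \<noteq> 0"
  shows "negligible {x. a * coord1 x + b * coord2 x = c}"
proof -
  define n :: "real^2" where "n = vector [a, (2 * b - a) / sqrt 3]"
  have "n \<bullet> x = a * coord1 x + b * coord2 x" for x
    by (simp add: n_def inner_vec_def sum_2 coord1_def coord2_def field_simps)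
  moreover have "n \<noteq> 0" using assms by (auto simp: n_def vec_eq_iff forall_2)
  ultimately show ?thesis using negligible_hyperplane[of n c] by simp
qed

lemma compression_admissible:
  assumes lam: "0 < lam" "lam < 1"
  shows "compression lam k \<in> admissible 1 k"
  unfolding admissible_def
proof (intro CollectI conjI ballI)
  show "continuous_on (closure (strip k)) (compression lam k)" by (rule continuous_comp_map)
next
  fix V assume "V \<in> lattice_triangulation 1"
  then obtain \<sigma> p where V: "V = unit_triangle \<sigma> p" and s: "\<sigma> \<in> {1, -1}" by (auto simp: lattice_triangulation_1 unit_triangles_def)
  define a b where "a = (if \<sigma> = 1 then fst p else fst p - 1)" and "b = (if \<sigma> = 1 then fst p + snd p else fst p + snd p - 1)"
  define \<alpha> where "\<alpha> = (if a < 0 then 1 else lam)"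
  define \<beta> where "\<beta> = (if int k \<le> a then 0 else if int k \<le> b then lam - 1 else 0)"
  define \<gamma> where "\<gamma> = (if int k \<le> a then lam else if int k \<le> b then lam else 1)"
  have "(compression lam k has_derivative coord_map \<alpha> \<beta> \<gamma>) (at x)" if x: "x \<in> strip k \<inter> open_triangle V" for x
  proof -
    have ab: "of_int a < coord1 x" "coord1 x < of_int a + 1" "of_int b < coord1 x + coord2 x" "coord1 x + coord2 x < of_int b + 1"
      using x s unfolding V Int_iff open_triangle_unit_triangle[OF s] by (auto simp: a_def b_def)
    have lt: "coord1 x < of_int n \<longleftrightarrow> a < n" "of_int n < coord1 x \<longleftrightarrow> n \<le> a" "coord1 x + coord2 x < of_int n \<longleftrightarrow> b < n" "of_int n < coord1 x + coord2 x \<longleftrightarrow> n \<le> b" for n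
      using ab by linarith+
    note lt' = lt[of 0] lt[of "int k"]
    have "0 < coord2 x" using x by (simp add: strip_coords)
    moreover have "coord1 x \<noteq> 0" "coord1 x \<noteq> real k" "coord1 x + coord2 x \<noteq> real k"
      using lt'[simplified] by linarith+
    ultimately have D: "(compression lam k has_derivative coord_map (if coord1 x < 0 then 1 else lam)
        (if real k < coord1 x then 0 else if real k < coord1 x + coord2 x then lam - 1 else 0)
        (if real k < coord1 x then lam else if real k < coord1 x + coord2 x then lam else 1)) (at x)"
      by (intro compression_derivative lam)
    have "coord1 x < 0 \<longleftrightarrow> a < 0" "real k < coord1 x \<longleftrightarrow> int k \<le> a" "real k < coord1 x + coord2 x \<longleftrightarrow> int k \<le> b"
      using lt'[simplified] by blast+
    thus ?thesis using D unfolding \<alpha>_def \<beta>_def \<gamma>_def by (simp only:)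
  qed
  thus "\<exists>A :: real^2^2. \<forall>x\<in>strip k \<inter> open_triangle V. (compression lam k has_derivative (*v) A) (at x)"
    by (intro exI[of _ "matrix (coord_map \<alpha> \<beta> \<gamma>)"]) (simp add: matrix_lin[abs_def])
next
  define N where "N = {x. 1 * coord1 x + 0 * coord2 x = 0} \<union> {x. 1 * coord1 x + 0 * coord2 x = real k} \<union> {x. 1 * coord1 x + 1 * coord2 x = real k}"
  have "negligible N" unfolding N_def by (intro negligible_Un negligible_coord_line) auto
  hence "AE x in lebesgue. x \<notin> N" by (intro AE_not_in) (simp add: negligible_iff_null_sets)
  thus "AE x in lebesgue. x \<in> strip k \<longrightarrow> det (jacobian (compression lam k) (at x)) > 0"
  proof (rule AE_mp, intro AE_I2 impI)
    fix x assume "x \<notin> N" "x \<in> strip k"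
    hence "0 < coord2 x" "coord1 x \<noteq> 0" "coord1 x \<noteq> real k" "coord1 x + coord2 x \<noteq> real k" by (auto simp: N_def strip_coords)
    from compression_derivative[OF this lam, THEN frechet_derivative_at, symmetric]
    show "det (jacobian (compression lam k) (at x)) > 0"
      unfolding jacobian_def by (simp add: det_matrix_lin lam)
  qed
qed

lemma compression_left:
  assumes "x \<in> strip k" "coord1 x < 0" "0 < lam" "lam < 1"
  shows "(compression lam k has_derivative (\<lambda>h. mat 1 *v h)) (at x)"
  using compression_derivative[of x k lam] assms by (simp add: strip_coords coord_map_id)

lemma compression_right:
  assumes "x \<in> strip k" "real k < coord1 x" "0 < lam" "lam < 1"
  shows "(compression lam k has_derivative (\<lambda>h. ((lam / 1) *\<^sub>R mat 1) *v h)) (at x)"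
proof -
  have "\<not> coord1 x < 0" "coord1 x \<noteq> 0" "0 < coord2 x" using assms by (auto simp: strip_coords)
  thus ?thesis using compression_derivative[of x k lam] assms
    by (simp add: coord_map_scale matrix_scaleR scaleR_matrix_vector_assoc[symmetric])
qed

lemma norm_w [simp]: "norm w1 = 1" "norm w2 = 1"
proof -
  have "(norm w1)\<^sup>2 = 1\<^sup>2" "(norm w2)\<^sup>2 = 1\<^sup>2" by (simp_all add: norm_coords)
  thus "norm w1 = 1" "norm w2 = 1" by (metis norm_ge_zero power2_eq_imp_eq zero_le_one)+
qed

lemma norm_hexdirs:
  assumes "d \<in> hexdirs" shows "norm (lattice_pt d) = 1"
proof -
  have "(norm (lattice_pt d))\<^sup>2 = 1\<^sup>2" unfolding norm_pt using assms by (auto simp: hexdirs_def)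
  thus ?thesis by (metis norm_ge_zero power2_eq_imp_eq zero_le_one)
qed

lemma compression_energy:
  assumes k: "1 \<le> k" and lam: "0 < lam" "lam < 1"
  shows "energy lam (compression lam k) 1 k \<le> ennreal (48 * (real k)\<^sup>2)"
proof -
  define v where "v = compression lam k"
  define F where "F = {e \<in> strip_bonds k. fst (fst e) \<in> {0..int k}}"
  define G where "G = (\<lambda>(p, d). (p, p + d)) ` (({0..int k} \<times> {0..int k}) \<times> hexdirs)"
  have finG: "finite G" by (simp add: G_def hexdirs_def)
  have FG: "F \<subseteq> G"
  proof
    fix e assume e: "e \<in> F"
    obtain p q where pq: "e = (p, q)" by (cases e)
    have "(p, q - p) \<in> ({0..int k} \<times> {0..int k}) \<times> hexdirs" using e by (cases p) (auto simp: pq F_def strip_bonds_def)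
    hence "(\<lambda>(p, d). (p, p + d)) (p, q - p) \<in> G" unfolding G_def by (rule imageI)
    thus "e \<in> G" by (simp add: pq)
  qed
  have finF: "finite F" using FG finG finite_subset by blast
  have "card G \<le> card (({0..int k} \<times> {0..int k}) \<times> hexdirs)" unfolding G_def by (rule card_image_le) (simp add: hexdirs_def)
  also have "\<dots> = (k + 1) * (k + 1) * 6"
  proof -
    have "card {0..int k} = k + 1" "card hexdirs = 6" by (simp_all add: hexdirs_def nat_add_distrib)
    thus ?thesis by (simp only: card_cartesian_product)
  qed
  finally have "card F \<le> (k + 1) * (k + 1) * 6" using card_mono[OF finG FG] by linarith
  hence cardF: "real (card F) \<le> 6 * (real k + 1)\<^sup>2"
  proof -
    have "real (card F) \<le> real ((k + 1) * (k + 1) * 6)" by (simp only: of_nat_le_iff \<open>card F \<le> (k + 1) * (k + 1) * 6\<close>)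
    thus ?thesis by (simp add: power2_eq_square algebra_simps)
  qed
  have left: "v (lattice_pt p) = lattice_pt p" if "fst p \<le> 0" "snd p \<in> {0..int k}" for p
  proof -
    have "real_of_int (fst p) \<le> 0" "0 \<le> real_of_int (snd p)" "real_of_int (snd p) \<le> real k" using that by auto
    hence "ramp k (lattice_pt p) = snd p" "min (coord1 (lattice_pt p)) (lam * coord1 (lattice_pt p)) = fst p"
      using mult_right_mono_neg[of lam 1 "real_of_int (fst p)"] lam by (auto simp: ramp_def)
    thus ?thesis by (simp add: v_def compression_def lattice_pt_def algebra_simps)
  qed
  have right: "v (lattice_pt p) = lam *\<^sub>R lattice_pt p" if "int k \<le> fst p" "snd p \<in> {0..int k}" for p
  proof -
    have "real k \<le> real_of_int (fst p)" "0 \<le> real_of_int (snd p)" using that by (auto simp: of_int_le_iff[of "int k", where ?'a = real, simplified])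
    hence "ramp k (lattice_pt p) = 0" "min (coord1 (lattice_pt p)) (lam * coord1 (lattice_pt p)) = lam * fst p"
      using mult_right_mono[of lam 1 "real_of_int (fst p)"] lam by (auto simp: ramp_def)
    thus ?thesis by (simp add: v_def compression_def lattice_pt_def algebra_simps)
  qed
  have zero: "bond_energy lam v e = 0" if e: "e \<in> strip_bonds k - F" for e
  proof -
    obtain p q where pq: "e = (p, q)" by (cases e)
    have h: "q - p \<in> hexdirs" and rows: "snd p \<in> {0..int k}" "snd q \<in> {0..int k}" and out: "fst p < 0 \<or> int k < fst p"
      using e by (auto simp: pq strip_bonds_def F_def)
    have d: "\<bar>fst q - fst p\<bar> \<le> 1" using h by (auto simp: hexdirs_def prod_eq_iff)
    have n: "norm (lattice_pt p - lattice_pt q) = 1" using norm_hexdirs[OF h] by (simp add: lattice_pt_diff norm_minus_commute)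
    from out show ?thesis
    proof
      assume "fst p < 0"
      hence "v (lattice_pt p) = lattice_pt p" "v (lattice_pt q) = lattice_pt q" using d rows by (auto intro!: left)
      thus ?thesis using n \<open>fst p < 0\<close> by (simp add: bond_energy_def pq rest_length_def)
    next
      assume p: "int k < fst p"
      hence "v (lattice_pt p) = lam *\<^sub>R lattice_pt p" "v (lattice_pt q) = lam *\<^sub>R lattice_pt q" using d rows by (auto intro!: right)
      hence "norm (v (lattice_pt p) - v (lattice_pt q)) = lam" using n lam by (simp flip: scaleR_diff_right)
      thus ?thesis using p by (simp add: bond_energy_def pq rest_length_def)
    qed
  qed
  have bound: "bond_energy lam v e \<le> 4" if e: "e \<in> F" for e
  proof -
    obtain p q where pq: "e = (p, q)" by (cases e)
    have h: "q - p \<in> hexdirs" using e by (auto simp: pq strip_bonds_def F_def)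
    have d: "\<bar>fst q - fst p\<bar> \<le> 1" "\<bar>snd q - snd p\<bar> \<le> 1" using h by (auto simp: hexdirs_def prod_eq_iff)
    have d': "\<bar>coord1 (lattice_pt p) - coord1 (lattice_pt q)\<bar> \<le> 1" "\<bar>coord2 (lattice_pt p) - coord2 (lattice_pt q)\<bar> \<le> 1" using d by (simp_all flip: of_int_diff)
    define X Y where "X = min (coord1 (lattice_pt p)) (lam * coord1 (lattice_pt p)) - min (coord1 (lattice_pt q)) (lam * coord1 (lattice_pt q))"
      and "Y = lam * (coord2 (lattice_pt p) - coord2 (lattice_pt q)) + (1 - lam) * (ramp k (lattice_pt p) - ramp k (lattice_pt q))"
    have "\<bar>lam * (coord1 (lattice_pt p) - coord1 (lattice_pt q))\<bar> \<le> 1"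
      using mult_mono[of lam 1 "\<bar>coord1 (lattice_pt p) - coord1 (lattice_pt q)\<bar>" 1] lam d' by (simp add: abs_mult)
    hence X: "\<bar>X\<bar> \<le> 1" unfolding X_def using d'(1) by (simp add: right_diff_distrib)
    have "\<bar>ramp k (lattice_pt p) - ramp k (lattice_pt q)\<bar> \<le> 1" unfolding ramp_def using d' by linarith
    hence rb: "\<bar>(1 - lam) * (ramp k (lattice_pt p) - ramp k (lattice_pt q))\<bar> \<le> (1 - lam) * 1"
      unfolding abs_mult using lam by (intro mult_mono) auto
    have tb: "\<bar>lam * (coord2 (lattice_pt p) - coord2 (lattice_pt q))\<bar> \<le> lam * 1"
      unfolding abs_mult using lam d' by (intro mult_mono) auto
    have "\<bar>Y\<bar> \<le> \<bar>lam * (coord2 (lattice_pt p) - coord2 (lattice_pt q))\<bar> + \<bar>(1 - lam) * (ramp k (lattice_pt p) - ramp k (lattice_pt q))\<bar>"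
      unfolding Y_def by (rule abs_triangle_ineq)
    also have "\<dots> \<le> lam * 1 + (1 - lam) * 1" by (rule add_mono[OF tb rb])
    finally have Y: "\<bar>Y\<bar> \<le> 1" by simp
    have "v (lattice_pt p) - v (lattice_pt q) = X *\<^sub>R w1 + Y *\<^sub>R w2" by (simp add: v_def compression_def X_def Y_def algebra_simps)
    hence "norm (v (lattice_pt p) - v (lattice_pt q)) \<le> \<bar>X\<bar> + \<bar>Y\<bar>"
      using norm_triangle_ineq[of "X *\<^sub>R w1" "Y *\<^sub>R w2"] by simp
    hence "norm (v (lattice_pt p) - v (lattice_pt q)) \<le> 2" using X Y by linarith
    moreover have "0 < rest_length lam p" "rest_length lam p \<le> 1" using lam by (auto simp: rest_length_def)
    ultimately have "\<bar>norm (v (lattice_pt p) - v (lattice_pt q)) - rest_length lam p\<bar> \<le> 2"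
      using norm_ge_zero[of "v (lattice_pt p) - v (lattice_pt q)"] by linarith
    hence "\<bar>norm (v (lattice_pt p) - v (lattice_pt q)) - rest_length lam p\<bar>\<^sup>2 \<le> 2\<^sup>2" by (rule power_mono) simp
    thus ?thesis by (simp add: bond_energy_def pq)
  qed
  have "(\<Sum>e\<in>F. bond_energy lam v e) \<le> real (card F) * 4" using sum_bounded_above[of F "bond_energy lam v" 4] bound by simp
  also have "\<dots> \<le> 6 * (real k + 1)\<^sup>2 * 4" using cardF by (rule mult_right_mono) simp
  also have "\<dots> \<le> 6 * (2 * real k)\<^sup>2 * 4" using k by (intro mult_right_mono mult_left_mono power_mono) auto
  finally have "(\<Sum>e\<in>F. bond_energy lam v e) / 2 \<le> 48 * (real k)\<^sup>2" by (simp add: power_mult_distrib)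
  moreover have "energy lam v 1 k = ennreal ((\<Sum>e\<in>F. bond_energy lam v e) / 2)"
    by (rule energy_finite[OF k finF _ zero]) (auto simp: F_def)
  ultimately show ?thesis by (simp add: v_def ennreal_leI)
qed

lemma transition_cost_upper:
  assumes k: "1 \<le> k" and lam: "0 < lam" "lam < 1"
  shows "transition_cost lam 1 k \<le> ennreal (48 * (real k)\<^sup>2)"
proof -
  define M where "M = 2 * real k"
  have l: "coord1 x < 0" if "x \<in> strip k" "x $ 1 < - M" for x
    using that unfolding strip_coords comp_coords M_def by auto
  have r: "real k < coord1 x" if "x \<in> strip k" "x $ 1 > M" for x
    using that unfolding strip_coords comp_coords M_def by auto
  have "transition_cost lam 1 k \<le> energy lam (compression lam k) 1 k"
    unfolding transition_cost_def
  proof (rule Inf_lower, intro CollectI exI[of _ "compression lam k"] exI[of _ M] conjI refl ballI impI)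
    show "M > 0" using k by (simp add: M_def)
    show "compression lam k \<in> admissible 1 k" by (rule compression_admissible[OF lam])
  next
    fix x assume x: "x \<in> strip k" "x $ 1 < - M"
    show "(compression lam k has_derivative (\<lambda>h. mat 1 *v h)) (at x)" by (rule compression_left[OF x(1) l[OF x] lam])
  next
    fix x assume x: "x \<in> strip k" "x $ 1 > M"
    show "(compression lam k has_derivative (\<lambda>h. ((lam / 1) *\<^sub>R mat 1) *v h)) (at x)" by (rule compression_right[OF x(1) r[OF x] lam])
  qed
  also have "\<dots> \<le> ennreal (48 * (real k)\<^sup>2)" by (rule compression_energy[OF k lam])
  finally show ?thesis .
qed

section \<open>Quadratic growth of the transition cost\<close>

theorem proposition2p5:
  fixes lam :: real
  assumes "0 < lam" and "lam < 1"
  shows "\<exists>C1 C2 :: real. C1 > 0 \<and> C2 > 0 \<and>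
    (\<forall>k::nat. k \<ge> 1 \<longrightarrow>
       ennreal (C1 * (real k)\<^sup>2) \<le> transition_cost lam 1 k \<and>
       transition_cost lam 1 k \<le> ennreal (C2 * (real k)\<^sup>2))"
proof (intro exI conjI allI impI)
  have "lam\<^sup>2 < 1" using assms by (simp add: power_strict_decreasing abs_square_less_1)
  thus "0 < min ((1 - lam)\<^sup>2 / 32) ((1 - lam\<^sup>2)\<^sup>2 / 576000000)" using assms by simp
  show "(0::real) < 48" by simp
  fix k :: nat assume k: "1 \<le> k"
  show "ennreal (min ((1 - lam)\<^sup>2 / 32) ((1 - lam\<^sup>2)\<^sup>2 / 576000000) * (real k)\<^sup>2) \<le> transition_cost lam 1 k"
    unfolding transition_cost_def by (rule Inf_greatest) (use energy_lower[OF k assms] in auto)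
  show "transition_cost lam 1 k \<le> ennreal (48 * (real k)\<^sup>2)" by (rule transition_cost_upper[OF k assms])
qed

end
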